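(* Let $M_1$ be a loopless matroid on ground set $E$ with $\beta(M_1)\le 2$ and let $M_2$ be a partition matroid on $E$ with $\beta(M_2)\le k$. (a) If $k\ge 3$ and $M_1$ has property (P), then $\beta(M_1\cap M_2)\le k$. (b) If $k\ge 4$ and $M_1$ has property (R+), then $\beta(M_1\cap M_2)\le k$. (c) If $k\ge 5$ and $M_1$ has property (R), then $\beta(M_1\cap M_2)\le k$.
   Context: A partition matroid is given by a partition of $E$ into classes; a set is independent iff it contains at most one element of each class. $\beta(M)$ is the minimum number of independent sets covering the ground set; $\beta(M_1\cap M_2)$ is the minimum number of common independent sets of $M_1$ and $M_2$ covering $E$. For a matroid with circuit set $\mathcal{C}$ and $X\subseteq E$, $\mathcal{C}[X]$ is the set of circuits contained in $X$. A graph on matroid elements covers a family of circuits if every circuit of the family contains both endpoints of some edge; graphs may have parallel edges. Property (R): for any bases $A,B$ there is a 2-regular graph with vertex set $A\triangle B$ covering $\mathcal{C}[A\cup B]$. Property (R+): for any bases $A,B$ there is a 2-regular graph with vertex set $A\triangle B$ whose cycles alternate between $A\setminus B$ and $B\setminus A$ covering $\mathcal{C}[A\cup B]$. Property (P): for any bases $A,B$ there is a path with vertex set $A\triangle B$ covering $\mathcal{C}[A\cup B]$. *)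

theory Defs
  imports Main "HOL-Library.Extended_Nat" "HOL-Library.Multiset" "HOL-Library.Disjoint_Sets"
begin

locale matroid =
  fixes E :: "'a set" and \<I> :: "'a set set"
  assumes finite_ground: "finite E"
    and indep_subset_ground: "X \<in> \<I> \<Longrightarrow> X \<subseteq> E"
    and empty_indep: "{} \<in> \<I>"
    and indep_subset: "X \<in> \<I> \<Longrightarrow> Y \<subseteq> X \<Longrightarrow> Y \<in> \<I>"
    and augmentation: "X \<in> \<I> \<Longrightarrow> Y \<in> \<I> \<Longrightarrow> card X < card Y \<Longrightarrow> \<exists>y\<in>Y - X. insert y X \<in> \<I>"

definition loopless :: "'a set \<Rightarrow> 'a set set \<Rightarrow> bool" where
  "loopless E \<I> \<longleftrightarrow> (\<forall>e\<in>E. {e} \<in> \<I>)"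

definition bases :: "'a set set \<Rightarrow> 'a set set" where
  "bases \<I> = {B \<in> \<I>. \<forall>X\<in>\<I>. B \<subseteq> X \<longrightarrow> X = B}"

definition circuits :: "'a set \<Rightarrow> 'a set set \<Rightarrow> 'a set set" where
  "circuits E \<I> = {C. C \<subseteq> E \<and> C \<notin> \<I> \<and> (\<forall>D. D \<subset> C \<longrightarrow> D \<in> \<I>)}"

definition circuits_in :: "'a set \<Rightarrow> 'a set set \<Rightarrow> 'a set \<Rightarrow> 'a set set" where
  "circuits_in E \<I> X = {C \<in> circuits E \<I>. C \<subseteq> X}"

definition partition_matroid :: "'a set \<Rightarrow> 'a set set \<Rightarrow> bool" where
  "partition_matroid E \<I> \<longleftrightarrow> finite E \<and>
     (\<exists>P. partition_on E P \<and> \<I> = {X. X \<subseteq> E \<and> (\<forall>c\<in>P. card (X \<inter> c) \<le> 1)})"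

text \<open>The value is \<open>\<infinity>\<close> if no finite subfamily covers \<open>E\<close>. The family \<open>\<I>\<close> need not be a matroid,
  so the common independent sets of two matroids are covered by taking \<open>\<I> = \<I>1 \<inter> \<I>2\<close>.\<close>

definition covering_number :: "'a set \<Rightarrow> 'a set set \<Rightarrow> enat" where
  "covering_number E \<I> = (INF \<F>\<in>{\<F>. finite \<F> \<and> \<F> \<subseteq> \<I> \<and> E \<subseteq> \<Union>\<F>}. enat (card \<F>))"

text \<open>A loopless multigraph is given by its vertex set and the multiset of its edges, each edge
  being the two-element set of its endpoints.\<close>

definition multigraph :: "'a set \<Rightarrow> 'a set multiset \<Rightarrow> bool" where
  "multigraph V F \<longleftrightarrow> (\<forall>e\<in>#F. e \<subseteq> V \<and> card e = 2)"

definition degree :: "'a set multiset \<Rightarrow> 'a \<Rightarrow> nat" where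
  "degree F v = size {#e \<in># F. v \<in> e#}"

definition two_regular :: "'a set \<Rightarrow> 'a set multiset \<Rightarrow> bool" where
  "two_regular V F \<longleftrightarrow> multigraph V F \<and> (\<forall>v\<in>V. degree F v = 2)"

definition covers :: "'a set multiset \<Rightarrow> 'a set set \<Rightarrow> bool" where
  "covers F \<C> \<longleftrightarrow> (\<forall>C\<in>\<C>. \<exists>e\<in>#F. e \<subseteq> C)"

definition edges_of_pairs :: "('a \<times> 'a) list \<Rightarrow> 'a set multiset" where
  "edges_of_pairs ps = mset (map (\<lambda>(u, v). {u, v}) ps)"

definition path_edges :: "'a list \<Rightarrow> 'a set multiset" where
  "path_edges vs = edges_of_pairs (zip vs (tl vs))"

definition cyclic_pairs :: "'a list \<Rightarrow> ('a \<times> 'a) list" where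
  "cyclic_pairs vs = zip vs (rotate1 vs)"

text \<open>A cycle of length two consists of two parallel edges, hence the multiset inclusion.\<close>

definition is_cycle :: "'a set multiset \<Rightarrow> 'a list \<Rightarrow> bool" where
  "is_cycle F vs \<longleftrightarrow> 2 \<le> length vs \<and> distinct vs \<and> edges_of_pairs (cyclic_pairs vs) \<subseteq># F"

definition alternates :: "'a set \<Rightarrow> 'a set \<Rightarrow> 'a list \<Rightarrow> bool" where
  "alternates X Y vs \<longleftrightarrow>
     (\<forall>(u, v)\<in>set (cyclic_pairs vs). (u \<in> X \<and> v \<in> Y) \<or> (u \<in> Y \<and> v \<in> X))"

definition property_R :: "'a set \<Rightarrow> 'a set set \<Rightarrow> bool" where
  "property_R E \<I> \<longleftrightarrow> (\<forall>A\<in>bases \<I>. \<forall>B\<in>bases \<I>. \<exists>F.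
     two_regular ((A - B) \<union> (B - A)) F \<and> covers F (circuits_in E \<I> (A \<union> B)))"

definition property_R_plus :: "'a set \<Rightarrow> 'a set set \<Rightarrow> bool" where
  "property_R_plus E \<I> \<longleftrightarrow> (\<forall>A\<in>bases \<I>. \<forall>B\<in>bases \<I>. \<exists>F.
     two_regular ((A - B) \<union> (B - A)) F \<and>
     (\<forall>vs. is_cycle F vs \<longrightarrow> alternates (A - B) (B - A) vs) \<and>
     covers F (circuits_in E \<I> (A \<union> B)))"

text \<open>A path is given by the list of its vertices in order; for \<open>A = B\<close> it is the empty path.\<close>

definition property_P :: "'a set \<Rightarrow> 'a set set \<Rightarrow> bool" where
  "property_P E \<I> \<longleftrightarrow> (\<forall>A\<in>bases \<I>. \<forall>B\<in>bases \<I>. \<exists>vs.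
     distinct vs \<and> set vs = (A - B) \<union> (B - A) \<and>
     covers (path_edges vs) (circuits_in E \<I> (A \<union> B)))"

end

theory Submission
  imports Defs "HOL-Library.FuncSet" "HOL-Library.Z2" "HOL-Combinatorics.Cycles"
begin

text \<open>
  Write \<open>E = A \<union> B\<close> for bases \<open>A\<close>, \<open>B\<close>. A set that spans no edge of the given graph contains no circuit,
  so it suffices to colour \<open>E\<close> with \<open>k\<close> colours such that neither an edge of the graph nor a class of
  the partition contains two points of the same colour. The case of larger \<open>k\<close> reduces to
  \<open>k = 3, 4, 5\<close>, since a colour class for a smaller \<open>k\<close> supplies an independent transversal.

  (a) This is the cycle-plus-triangles theorem for a path. Colours are the nonzero elements of \<open>GF(4)\<close>.
  Summing \<open>x\<^sub>0 \<Prod>\<^sub>i (x\<^sub>i + x\<^sub>i\<^sub>+\<^sub>1)\<close> over the colourings that are injective on all triples counts, modulo \<open>2\<close>,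
  the ways to delete one point of each triple so that in each remaining pair the two points have
  different parity in the order of the remaining points. This number is odd: up to terms
  that vanish it is the sum of the permanents of \<open>I + W\<close> over the field with two elements, where the
  symmetric matrix \<open>W\<close> records the crossings of the pairs. The crossings with a fixed pair sum to \<open>0\<close> over
  the three pairs of a triple, which makes all permutations but the identity cancel.

  (b) The graph is a union of two matchings. Halve the classes twice, each time splitting the edges of
  one of the matchings.

  (c) By Hall's theorem and a matching exchange argument there is a set \<open>M\<close> inducing a matching, meeting
  every cycle of length at least \<open>3\<close>, with at most two points in each class and at most three
  points of each class outside. Two colours suffice for \<open>M\<close>, and three colours for the linear forest
  outside \<open>M\<close> by (a).
\<close>

section \<open>A parity lemma over the field with two elements\<close>

declare add_bit_eq_xor [simp del] mult_bit_eq_and [simp del]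

lemma bit_add_self [simp]: "(x::bit) + x = 0"
  by (cases x) auto

lemma of_nat_bit_odd: "odd n \<Longrightarrow> (of_nat n :: bit) = 1"
  by (elim oddE) (simp add: mult_2)

text \<open>The terms of \<open>a\<close> and \<open>\<iota> a\<close> are equal and distinct in
  position, so they cancel in pairs in characteristic 2.\<close>

lemma sum_bit_fixpoint_free_involution:
  fixes h :: "'a \<Rightarrow> bit"
  assumes "finite A"
    and "\<And>a. a \<in> A \<Longrightarrow> \<iota> a \<in> A \<and> \<iota> (\<iota> a) = a \<and> \<iota> a \<noteq> a \<and> h (\<iota> a) = h a"
  shows "(\<Sum>a\<in>A. h a) = 0"
  using assms
proof (induction "card A" arbitrary: A rule: less_induct)
  case less
  show ?case
  proof (cases "A = {}")
    case False
    then obtain a where a: "a \<in> A" by blast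
    let ?B = "A - {a, \<iota> a}"
    have ia: "\<iota> a \<in> A" "\<iota> a \<noteq> a" "\<iota> (\<iota> a) = a" "h (\<iota> a) = h a"
      using less.prems(2)[OF a] by auto
    have "(\<Sum>a\<in>?B. h a) = 0"
    proof (rule less.hyps)
      show "card ?B < card A"
        using a less.prems(1) by (intro psubset_card_mono) auto
      show "finite ?B" using less.prems(1) by simp
      fix b assume "b \<in> ?B"
      then show "\<iota> b \<in> ?B \<and> \<iota> (\<iota> b) = b \<and> \<iota> b \<noteq> b \<and> h (\<iota> b) = h b"
        using less.prems(2)[of b] ia by auto
    qed
    moreover have "A = insert a (insert (\<iota> a) ?B)" using a ia by auto
    moreover have "(\<Sum>a\<in>insert a (insert (\<iota> a) ?B). h a) = h a + (h (\<iota> a) + (\<Sum>a\<in>?B. h a))"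
      using less.prems(1) ia(2) by (subst sum.insert; simp)+
    ultimately show ?thesis using ia(4) by simp
  qed simp
qed

text \<open>Once all coordinates other than \<open>s\<close> are fixed, \<open>R \<zeta>\<close> and
  \<open>\<zeta> t\<close> are constant, and summing over the value at \<open>s\<close> leaves a
  column sum of \<open>b\<close>, which vanishes.\<close>

lemma sum_PiE_linear_coordinate_eq_0:
  fixes b :: "'k \<Rightarrow> 'k \<Rightarrow> bit"
  assumes "finite T" "s \<in> T" "t \<in> T" "s \<noteq> t" "finite K"
    and zero: "\<And>k'. k' \<in> K \<Longrightarrow> (\<Sum>k\<in>K. b k k') = 0"
    and R: "\<And>\<zeta> k. R (\<zeta>(s := k)) = R \<zeta>"
  shows "(\<Sum>\<zeta>\<in>PiE T (\<lambda>_. K). b (\<zeta> s) (\<zeta> t) * R \<zeta>) = 0"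
proof -
  define U where "U = T - {s}"
  have T: "T = insert s U" "s \<notin> U" "t \<in> U" using assms(2-4) by (auto simp: U_def)
  have "(\<Sum>\<zeta>\<in>PiE T (\<lambda>_. K). b (\<zeta> s) (\<zeta> t) * R \<zeta>)
      = (\<Sum>(k, \<zeta>)\<in>K \<times> PiE U (\<lambda>_. K). b k (\<zeta> t) * R \<zeta>)"
    unfolding T(1) PiE_insert_eq
    by (subst sum.reindex[OF inj_combinator[OF T(2)]])
       (use assms(4) in \<open>auto intro!: sum.cong simp: R\<close>)
  also have "\<dots> = (\<Sum>\<zeta>\<in>PiE U (\<lambda>_. K). \<Sum>k\<in>K. b k (\<zeta> t) * R \<zeta>)"
    by (subst sum.cartesian_product[symmetric]) (rule sum.swap)
  also have "\<dots> = 0"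
  proof (rule sum.neutral, rule ballI)
    fix \<zeta> assume "\<zeta> \<in> PiE U (\<lambda>_. K)"
    then have "\<zeta> t \<in> K" using T(3) by auto
    then show "(\<Sum>k\<in>K. b k (\<zeta> t) * R \<zeta>) = 0"
      using zero by (simp add: sum_distrib_right[symmetric])
  qed
  finally show ?thesis .
qed

text \<open>Expanding the product over all maps \<open>f : T \<rightarrow> T\<close>, the non-surjective maps contribute \<open>0\<close> since
  the product is then linear in some coordinate of \<open>\<zeta>\<close>, a permutation cancels against its inverse, and
  so only involutions are left; a transposed pair again gives a linear coordinate because
  \<open>b\<^sup>2 = b\<close>.\<close>

lemma sum_prod_symmetric_form_eq_1:
  fixes b :: "'t \<Rightarrow> 'k \<Rightarrow> 't \<Rightarrow> 'k \<Rightarrow> bit"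
  assumes fin: "finite T" "finite K" and odd: "odd (card K)"
    and sym: "\<And>t k t' k'. \<lbrakk>t \<in> T; t' \<in> T; t \<noteq> t'; k \<in> K; k' \<in> K\<rbrakk> \<Longrightarrow> b t k t' k' = b t' k' t k"
    and zero: "\<And>t t' k'. \<lbrakk>t \<in> T; t' \<in> T; t \<noteq> t'; k' \<in> K\<rbrakk> \<Longrightarrow> (\<Sum>k\<in>K. b t k t' k') = 0"
  shows "(\<Sum>\<zeta>\<in>PiE T (\<lambda>_. K). \<Prod>t\<in>T. 1 + (\<Sum>t'\<in>T - {t}. b t (\<zeta> t) t' (\<zeta> t'))) = 1"
proof -
  \<comment> \<open>With \<open>1\<close> on the diagonal, each factor becomes a row sum of
    \<open>I + W\<close>, and \<open>H f\<close> collects the terms in which \<open>f t\<close> is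
    the column chosen in row \<open>t\<close>.\<close>
  define g where "g \<zeta> t t' = (if t' = t then 1 else b t (\<zeta> t) t' (\<zeta> t'))" for \<zeta> t t'
  define H where "H f = (\<Sum>\<zeta>\<in>PiE T (\<lambda>_. K). \<Prod>t\<in>T. g \<zeta> t (f t))" for f
  let ?F = "PiE T (\<lambda>_. T)"
  let ?e = "restrict (\<lambda>t. t) T"
  let ?i = "\<lambda>f. restrict (inv_into T f) T"
  have g_sym: "g \<zeta> t t' = g \<zeta> t' t" if "\<zeta> \<in> PiE T (\<lambda>_. K)" "t \<in> T" "t' \<in> T" for \<zeta> t t'
    using that sym[of t t' "\<zeta> t" "\<zeta> t'"] by (auto simp: g_def PiE_mem)
  have "(\<Sum>\<zeta>\<in>PiE T (\<lambda>_. K). \<Prod>t\<in>T. 1 + (\<Sum>t'\<in>T - {t}. b t (\<zeta> t) t' (\<zeta> t')))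
      = (\<Sum>\<zeta>\<in>PiE T (\<lambda>_. K). \<Prod>t\<in>T. \<Sum>t'\<in>T. g \<zeta> t t')"
  proof (intro sum.cong prod.cong refl)
    fix \<zeta> t assume t: "t \<in> T"
    have "(\<Sum>t'\<in>T. g \<zeta> t t') = g \<zeta> t t + (\<Sum>t'\<in>T - {t}. g \<zeta> t t')"
      using fin t by (simp add: sum.remove)
    also have "(\<Sum>t'\<in>T - {t}. g \<zeta> t t') = (\<Sum>t'\<in>T - {t}. b t (\<zeta> t) t' (\<zeta> t'))"
      by (rule sum.cong) (auto simp: g_def)
    finally show "1 + (\<Sum>t'\<in>T - {t}. b t (\<zeta> t) t' (\<zeta> t')) = (\<Sum>t'\<in>T. g \<zeta> t t')"
      by (simp add: g_def)
  qed
  also have "\<dots> = (\<Sum>f\<in>?F. H f)"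
    unfolding H_def by (subst sum.swap) (use fin in \<open>simp add: prod_sum_PiE\<close>)
  finally have *: "(\<Sum>\<zeta>\<in>PiE T (\<lambda>_. K). \<Prod>t\<in>T. 1 + (\<Sum>t'\<in>T - {t}. b t (\<zeta> t) t' (\<zeta> t'))) = (\<Sum>f\<in>?F. H f)" .

  have finF: "finite ?F" using fin by (simp add: finite_PiE)
  have H_nonsurj: "H f = 0" if f: "f \<in> ?F" "f ` T \<noteq> T" for f
  proof -
    \<comment> \<open>As \<open>f\<close> misses \<open>s\<close>, the coordinate
      \<open>\<zeta> s\<close> enters only through the factor of row \<open>s\<close>.\<close>
    obtain s where s: "s \<in> T" "s \<notin> f ` T" using f by auto
    have fs: "f s \<in> T" "f s \<noteq> s" using f s by (auto intro: rev_image_eqI)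
    define R where "R \<zeta> = (\<Prod>t\<in>T - {s}. g \<zeta> t (f t))" for \<zeta>
    have R: "R (\<zeta>(s := k)) = R \<zeta>" for \<zeta> k
      unfolding R_def using s by (intro prod.cong) (auto simp: g_def)
    have "H f = (\<Sum>\<zeta>\<in>PiE T (\<lambda>_. K). b s (\<zeta> s) (f s) (\<zeta> (f s)) * R \<zeta>)"
      unfolding H_def
    proof (rule sum.cong[OF refl])
      fix \<zeta>
      show "(\<Prod>t\<in>T. g \<zeta> t (f t)) = b s (\<zeta> s) (f s) (\<zeta> (f s)) * R \<zeta>"
        using fin s fs by (simp add: prod.remove R_def g_def[of \<zeta> s])
    qed
    also have "\<dots> = 0"
      by (rule sum_PiE_linear_coordinate_eq_0[where b = "\<lambda>k k'. b s k (f s) k'"])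
         (use fin s fs R zero in auto)
    finally show ?thesis .
  qed
  have H_invol: "H f = 0" if f: "f \<in> ?F" "f ` T = T" "?i f = f" "f \<noteq> ?e" for f
  proof -
    have inj: "inj_on f T" using f fin by (simp add: eq_card_imp_inj_on)
    obtain s where s: "s \<in> T" "f s \<noteq> s" using f by fastforce
    have ff: "f (f t) = t" if "t \<in> T" for t
    proof -
      have "f t = inv_into T f t" using f(3) that by (metis restrict_apply')
      then show ?thesis using f(2) that by (metis f_inv_into_f)
    qed
    have fs: "f s \<in> T" using f s by auto
    \<comment> \<open>The factors of \<open>s\<close> and \<open>f s\<close> are equal by symmetry.
      No other factor involves \<open>\<zeta> s\<close>, since \<open>f t = s\<close> forces
      \<open>t = f s\<close>.\<close>
    define R where "R \<zeta> = (\<Prod>t\<in>T - {s} - {f s}. g \<zeta> t (f t))" for \<zeta>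
    have R: "R (\<zeta>(s := k)) = R \<zeta>" for \<zeta> k
      unfolding R_def
    proof (intro prod.cong refl)
      fix t assume t: "t \<in> T - {s} - {f s}"
      then have "f t \<noteq> s" using ff[of t] by auto
      then show "g (\<zeta>(s := k)) t (f t) = g \<zeta> t (f t)" using t by (auto simp: g_def)
    qed
    have "H f = (\<Sum>\<zeta>\<in>PiE T (\<lambda>_. K). b s (\<zeta> s) (f s) (\<zeta> (f s)) * R \<zeta>)"
      unfolding H_def
    proof (rule sum.cong[OF refl])
      fix \<zeta> assume \<zeta>: "\<zeta> \<in> PiE T (\<lambda>_. K)"
      have "(\<Prod>t\<in>T. g \<zeta> t (f t)) = g \<zeta> s (f s) * (g \<zeta> (f s) (f (f s)) * R \<zeta>)"
        using fin s fs by (simp add: prod.remove R_def)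
      also have "g \<zeta> (f s) (f (f s)) = g \<zeta> s (f s)"
        using g_sym[OF \<zeta> s(1) fs] ff[OF s(1)] by simp
      also have "g \<zeta> s (f s) = b s (\<zeta> s) (f s) (\<zeta> (f s))" using s by (simp add: g_def)
      finally show "(\<Prod>t\<in>T. g \<zeta> t (f t)) = b s (\<zeta> s) (f s) (\<zeta> (f s)) * R \<zeta>"
        by (cases "b s (\<zeta> s) (f s) (\<zeta> (f s))") auto
    qed
    also have "\<dots> = 0"
      by (rule sum_PiE_linear_coordinate_eq_0[where b = "\<lambda>k k'. b s k (f s) k'"])
         (use fin s fs R zero in auto)
    finally show ?thesis .
  qed
  \<comment> \<open>The permutations that are not involutions; they are paired with their
    inverses.\<close>
  define N where "N = {f \<in> ?F. f ` T = T \<and> ?i f \<noteq> f}"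
  have H_N: "(\<Sum>f\<in>N. H f) = 0"
  proof (rule sum_bit_fixpoint_free_involution[where \<iota> = ?i])
    show "finite N" using finF by (simp add: N_def)
    fix f assume f: "f \<in> N"
    then have inj: "inj_on f T" and im: "f ` T = T" and fF: "f \<in> ?F"
      using fin by (auto simp: N_def eq_card_imp_inj_on)
    have bij: "bij_betw f T T" using inj im by (simp add: bij_betw_def)
    have bij': "bij_betw (?i f) T T" using bij_betw_inv_into[OF bij] by (simp cong: bij_betw_cong)
    have ii: "?i (?i f) = f"
    proof
      fix t
      show "?i (?i f) t = f t"
      proof (cases "t \<in> T")
        case True
        then have ft: "f t \<in> T" using im by auto
        have "inv_into T (?i f) t = f t"
          by (rule inv_into_f_eq)
             (use bij' ft inj True in \<open>auto simp: bij_betw_def inv_into_f_f\<close>)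
        then show ?thesis using True by simp
      next
        case False
        then show ?thesis using fF by (auto simp: PiE_def extensional_def)
      qed
    qed
    have "H (?i f) = H f"
      unfolding H_def
    proof (rule sum.cong[OF refl])
      fix \<zeta> assume \<zeta>: "\<zeta> \<in> PiE T (\<lambda>_. K)"
      \<comment> \<open>Reindexing by \<open>f\<close> turns each factor into
        \<open>g \<zeta> (f t) t\<close>, which is \<open>g \<zeta> t (f t)\<close> by
        symmetry.\<close>
      have "(\<Prod>t\<in>T. g \<zeta> t (?i f t)) = (\<Prod>t\<in>T. g \<zeta> (f t) (?i f (f t)))"
        by (rule prod.reindex_bij_betw[OF bij, symmetric])
      also have "\<dots> = (\<Prod>t\<in>T. g \<zeta> t (f t))"
        using inj im g_sym[OF \<zeta>] by (intro prod.cong) (auto simp: inv_into_f_f)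
      finally show "(\<Prod>t\<in>T. g \<zeta> t (?i f t)) = (\<Prod>t\<in>T. g \<zeta> t (f t))" .
    qed
    moreover have "?i f \<in> N"
      using bij' f ii by (auto simp: N_def bij_betw_def)
    ultimately show "?i f \<in> N \<and> ?i (?i f) = f \<and> ?i f \<noteq> f \<and> H (?i f) = H f"
      using ii f by (simp add: N_def)
  qed
  have e: "?e \<in> ?F - N"
  proof -
    have "inv_into T ?e t = t" if "t \<in> T" for t
      by (rule inv_into_f_eq) (use that in \<open>auto simp: inj_on_def\<close>)
    then show ?thesis by (auto simp: N_def fun_eq_iff restrict_def)
  qed
  have "(\<Sum>f\<in>?F. H f) = (\<Sum>f\<in>?F - N. H f) + (\<Sum>f\<in>N. H f)"
    using finF by (intro sum.subset_diff) (auto simp: N_def)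
  also have "(\<Sum>f\<in>?F - N. H f) = H ?e + (\<Sum>f\<in>?F - N - {?e}. H f)"
    using finF e by (intro sum.remove) auto
  also have "(\<Sum>f\<in>?F - N - {?e}. H f) = 0"
  proof (rule sum.neutral, rule ballI)
    fix f assume "f \<in> ?F - N - {?e}"
    then show "H f = 0" using H_nonsurj[of f] H_invol[of f] by (cases "f ` T = T") (simp_all add: N_def)
  qed
  \<comment> \<open>The identity contributes \<open>1\<close> for every \<open>\<zeta>\<close>, and
    a power of the odd number \<open>card K\<close> is odd.\<close>
  also have "H ?e = of_nat (card (PiE T (\<lambda>_. K)))"
    by (simp add: H_def g_def)
  also have "\<dots> = 1"
    using fin odd by (intro of_nat_bit_odd) (simp add: card_PiE)
  finally show ?thesis using * H_N by simp
qed

section \<open>Paths plus triangles\<close>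

datatype gf4 = GF0 | GF1 | GFw | GFv

instantiation gf4 :: comm_ring_1
begin

definition zero_gf4 :: gf4 where "0 = GF0"
definition one_gf4 :: gf4 where "1 = GF1"

fun plus_gf4 :: "gf4 \<Rightarrow> gf4 \<Rightarrow> gf4" where
  "GF0 + y = y"
| "x + GF0 = x"
| "GF1 + GF1 = GF0" | "GF1 + GFw = GFv" | "GF1 + GFv = GFw"
| "GFw + GF1 = GFv" | "GFw + GFw = GF0" | "GFw + GFv = GF1"
| "GFv + GF1 = GFw" | "GFv + GFw = GF1" | "GFv + GFv = GF0"

fun times_gf4 :: "gf4 \<Rightarrow> gf4 \<Rightarrow> gf4" where
  "GF0 * y = GF0"
| "GF1 * y = y"
| "x * GF0 = GF0"
| "x * GF1 = x"
| "GFw * GFw = GFv" | "GFw * GFv = GF1"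
| "GFv * GFw = GF1" | "GFv * GFv = GFw"

definition uminus_gf4 :: "gf4 \<Rightarrow> gf4" where "- (x::gf4) = x"
definition minus_gf4 :: "gf4 \<Rightarrow> gf4 \<Rightarrow> gf4" where "x - (y::gf4) = x + y"

instance
proof
  fix a b c :: gf4
  show "a + b + c = a + (b + c)" by (cases a; cases b; cases c) simp_all
  show "a + b = b + a" by (cases a; cases b) simp_all
  show "0 + a = a" by (simp add: zero_gf4_def)
  show "- a + a = 0" by (cases a) (simp_all add: zero_gf4_def uminus_gf4_def)
  show "a - b = a + - b" by (simp add: minus_gf4_def uminus_gf4_def)
  show "a * b * c = a * (b * c)" by (cases a; cases b; cases c) simp_all
  show "a * b = b * a" by (cases a; cases b) simp_all
  show "1 * a = a" by (simp add: one_gf4_def)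
  show "(a + b) * c = a * c + b * c" by (cases a; cases b; cases c) simp_all
  show "(0::gf4) \<noteq> 1" by (simp add: zero_gf4_def one_gf4_def)
qed

end

lemma gf4_add_self [simp]: "(x::gf4) + x = 0"
  by (cases x) (simp_all add: zero_gf4_def)

lemma of_nat_gf4_odd: "odd n \<Longrightarrow> (of_nat n :: gf4) = 1"
  by (elim oddE) (simp add: mult_2)

definition gf4_rainbows :: "gf4 list set" where
  "gf4_rainbows = {[GF1, GFw, GFv], [GF1, GFv, GFw], [GFw, GF1, GFv],
                   [GFw, GFv, GF1], [GFv, GF1, GFw], [GFv, GFw, GF1]}"

lemma lessThan_3: "{..<3} = {0, 1, 2::nat}"
  by auto

text \<open>In characteristic 2 the sum is the determinant of a matrix of powers of the three
  nonzero elements. It vanishes if two exponents agree; otherwise it is the Vandermonde product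
  \<open>(1 + w) (1 + v) (w + v) = v w 1 = 1\<close>. The proof checks all exponent triples.\<close>

lemma sum_gf4_rainbows_monomial:
  fixes \<epsilon> :: "nat \<Rightarrow> nat"
  assumes "\<And>k. k < 3 \<Longrightarrow> \<epsilon> k \<le> 2"
  shows "(\<Sum>p\<in>gf4_rainbows. \<Prod>k<3. (p ! k) ^ \<epsilon> k) = of_bool (inj_on \<epsilon> {..<3})"
proof -
  have "\<epsilon> 0 \<in> {0, 1, 2}" "\<epsilon> 1 \<in> {0, 1, 2}" "\<epsilon> 2 \<in> {0, 1, 2}"
    using assms[of 0] assms[of 1] assms[of 2] by auto
  then show ?thesis
    by (elim insertE emptyE)
       (simp_all add: gf4_rainbows_def lessThan_3 power2_eq_square zero_gf4_def one_gf4_def)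
qed

text \<open>Expanding \<open>x\<^sub>0 (x\<^sub>0 + x\<^sub>1) (x\<^sub>1 + x\<^sub>2) \<cdots>\<close>, this is the exponent of \<open>x\<^sub>i\<close> when \<open>B\<close> is the set of the
  factors \<open>x\<^sub>j + x\<^sub>j\<^sub>+\<^sub>1\<close> from which \<open>x\<^sub>j\<close> is chosen.\<close>

definition path_exponent :: "nat set \<Rightarrow> nat \<Rightarrow> nat" where
  "path_exponent B i = of_bool (i \<in> B) + of_bool (i = 0 \<or> i - 1 \<notin> B)"

lemma path_exponent_le: "path_exponent B i \<le> 2"
  by (simp add: path_exponent_def)

lemma path_product_expand:
  fixes x :: "nat \<Rightarrow> 'c::comm_semiring_1"
  shows "x 0 * (\<Prod>i<m. x i + x (Suc i)) = (\<Sum>B\<in>Pow {..<m}. \<Prod>i<Suc m. x i ^ path_exponent B i)"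
proof -
  have "x 0 * (\<Prod>i<m. x i + x (Suc i))
      = (\<Sum>B\<in>Pow {..<m}. x 0 * ((\<Prod>i\<in>B. x i) * (\<Prod>i\<in>{..<m} - B. x (Suc i))))"
    by (simp add: prod_add sum_distrib_left)
  also have "\<dots> = (\<Sum>B\<in>Pow {..<m}. \<Prod>i<Suc m. x i ^ path_exponent B i)"
  proof (rule sum.cong[OF refl])
    fix B assume "B \<in> Pow {..<m}"
    then have B: "B \<subseteq> {..<m}" by simp
    \<comment> \<open>The first indicator stands for the left summand chosen from the factor of
      \<open>i\<close>. The second one stands for the right summand chosen from the factor of
      \<open>i - 1\<close>, or for the leading factor \<open>x 0\<close> if
      \<open>i = 0\<close>.\<close>
    have "(\<Prod>i<Suc m. x i ^ path_exponent B i)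
        = (\<Prod>i<Suc m. x i ^ of_bool (i \<in> B)) * (\<Prod>i<Suc m. x i ^ of_bool (i = 0 \<or> i - 1 \<notin> B))"
      by (simp add: path_exponent_def power_add prod.distrib)
    also have "(\<Prod>i<Suc m. x i ^ of_bool (i \<in> B)) = (\<Prod>i\<in>B. x i)"
      by (rule prod.mono_neutral_cong_right) (use B in auto)
    also have "(\<Prod>i<Suc m. x i ^ of_bool (i = 0 \<or> i - 1 \<notin> B))
        = x 0 * (\<Prod>i<m. x (Suc i) ^ of_bool (i \<notin> B))"
      by (simp only: prod.lessThan_Suc_shift) simp
    also have "(\<Prod>i<m. x (Suc i) ^ of_bool (i \<notin> B)) = (\<Prod>i\<in>{..<m} - B. x (Suc i))"
      by (rule prod.mono_neutral_cong_right) auto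
    finally show "x 0 * ((\<Prod>i\<in>B. x i) * (\<Prod>i\<in>{..<m} - B. x (Suc i)))
        = (\<Prod>i<Suc m. x i ^ path_exponent B i)" by (simp add: ac_simps)
  qed
  finally show ?thesis .
qed

lemma less_3_cases: "k < (3::nat) \<Longrightarrow> k = 0 \<or> k = 1 \<or> k = 2"
  by auto

lemma lessThan_3_minus:
  assumes "k < (3::nat)"
  obtains a b where "{..<3} - {k} = {a, b}" "a \<noteq> b" "{..<3} = {k, a, b}" "a \<noteq> k" "b \<noteq> k"
proof -
  consider "k = 0" | "k = 1" | "k = 2" using assms by linarith
  then show ?thesis
  proof cases
    case 1 then show ?thesis by (intro that[of 1 2]) auto
  next
    case 2 then show ?thesis by (intro that[of 0 2]) auto
  next
    case 3 then show ?thesis by (intro that[of 0 1]) auto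
  qed
qed

section \<open>Deleting one point of each triple\<close>

text \<open>\<open>q t k\<close> is the position on the path \<open>0, ..., n - 1\<close> of point
  \<open>k\<close> of the triple \<open>t\<close>.\<close>

locale triples =
  fixes T :: "'t set" and q :: "'t \<Rightarrow> nat \<Rightarrow> nat" and n :: nat
  assumes finite_T: "finite T"
    and bij_q: "bij_betw (\<lambda>(t, k). q t k) (T \<times> {..<3}) {..<n}"
begin

lemma q_less: "t \<in> T \<Longrightarrow> k < 3 \<Longrightarrow> q t k < n"
  using bij_betwE[OF bij_q] by force

lemma q_eq_iff:
  "t \<in> T \<Longrightarrow> k < 3 \<Longrightarrow> t' \<in> T \<Longrightarrow> k' < 3 \<Longrightarrow> q t k = q t' k' \<longleftrightarrow> t = t' \<and> k = k'"
  using bij_q by (auto simp: bij_betw_def inj_on_def)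

lemma q_surj:
  assumes "i < n" obtains t k where "t \<in> T" "k < 3" "i = q t k"
proof -
  have "i \<in> (\<lambda>(t, k). q t k) ` (T \<times> {..<3})" using assms bij_q by (simp add: bij_betw_def)
  then show ?thesis using that by auto
qed

text \<open>A choice \<open>\<zeta>\<close> of one element of each triple is read as a set of deleted points.
  \<open>rank \<zeta> i\<close> is the parity of the number of points up to \<open>i\<close> that are not deleted.\<close>

definition rank :: "('t \<Rightarrow> nat) \<Rightarrow> nat \<Rightarrow> bit" where
  "rank \<zeta> i = (\<Sum>t\<in>T. \<Sum>k\<in>{..<3} - {\<zeta> t}. of_bool (q t k \<le> i))"

text \<open>Over the field with two elements the sum is \<open>1\<close> exactly if the two points
  kept from the triple have ranks of different parity.\<close>

definition balanced :: "('t \<Rightarrow> nat) set" where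
  "balanced = {\<zeta> \<in> PiE T (\<lambda>_. {..<3}). \<forall>t\<in>T. (\<Sum>a\<in>{..<3} - {\<zeta> t}. rank \<zeta> (q t a)) = 1}"

text \<open>Expanding the ranks, the sum over the two kept points of \<open>t\<close> is
  \<open>1\<close> plus crossing numbers with the other triples. So the indicator of
  \<open>balanced\<close> is the product of row sums in
  \<open>sum_prod_symmetric_form_eq_1\<close>.\<close>

lemma odd_card_balanced: "odd (card balanced)"
proof -
  define b :: "'t \<Rightarrow> nat \<Rightarrow> 't \<Rightarrow> nat \<Rightarrow> bit" where
    "b t k t' k' = (\<Sum>a\<in>{..<3} - {k}. \<Sum>a'\<in>{..<3} - {k'}. of_bool (q t' a' \<le> q t a))" for t k t' k'
  have ind: "(\<Sum>a\<in>{..<3} - {\<zeta> t}. rank \<zeta> (q t a)) = 1 + (\<Sum>t'\<in>T - {t}. b t (\<zeta> t) t' (\<zeta> t'))"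
    if \<zeta>: "\<zeta> \<in> PiE T (\<lambda>_. {..<3})" and t: "t \<in> T" for \<zeta> t
  proof -
    have "(\<Sum>a\<in>{..<3} - {\<zeta> t}. rank \<zeta> (q t a)) = (\<Sum>t'\<in>T. b t (\<zeta> t) t' (\<zeta> t'))"
      unfolding rank_def b_def by (rule sum.swap)
    also have "\<dots> = b t (\<zeta> t) t (\<zeta> t) + (\<Sum>t'\<in>T - {t}. b t (\<zeta> t) t' (\<zeta> t'))"
      using finite_T t by (rule sum.remove)
    \<comment> \<open>Within one triple there are two reflexive comparisons and exactly one strict
      one, hence three in total.\<close>
    also have "b t (\<zeta> t) t (\<zeta> t) = 1"
    proof -
      have "\<zeta> t < 3" using \<zeta> t by auto
      then obtain a a' where a: "{..<3} - {\<zeta> t} = {a, a'}" "a \<noteq> a'" "{..<3} = {\<zeta> t, a, a'}"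
        by (rule lessThan_3_minus)
      then have "a < 3" "a' < 3" by auto
      then have "q t a \<noteq> q t a'" using q_eq_iff[of t a t a'] t a by auto
      then show ?thesis using a(2) by (auto simp: b_def a(1) not_le simp del: sum_of_bool_eq)
    qed
    finally show ?thesis .
  qed
  have "(1::bit) = (\<Sum>\<zeta>\<in>PiE T (\<lambda>_. {..<3}). \<Prod>t\<in>T. 1 + (\<Sum>t'\<in>T - {t}. b t (\<zeta> t) t' (\<zeta> t')))"
  proof (rule sum_prod_symmetric_form_eq_1[symmetric])
    fix t k t' k' assume *: "t \<in> T" "t' \<in> T" "t \<noteq> t'" "k \<in> {..<3::nat}" "k' \<in> {..<3::nat}"
    \<comment> \<open>For distinct triples each of the four pairs of kept points is ordered in
      exactly one way, so both sides together count four comparisons.\<close>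
    have "b t k t' k' + b t' k' t k
        = (\<Sum>a\<in>{..<3} - {k}. \<Sum>a'\<in>{..<3} - {k'}. of_bool (q t' a' \<le> q t a) + of_bool (q t a \<le> q t' a'))"
      unfolding b_def by (subst (2) sum.swap) (simp add: sum.distrib)
    also have "\<dots> = (\<Sum>a\<in>{..<3} - {k}. \<Sum>a'\<in>{..<3} - {k'}. 1)"
    proof (intro sum.cong refl)
      fix a a' assume "a \<in> {..<3} - {k}" "a' \<in> {..<3} - {k'}"
      then have "q t a \<noteq> q t' a'" using q_eq_iff[of t a t' a'] * by auto
      then show "(of_bool (q t' a' \<le> q t a) + of_bool (q t a \<le> q t' a') :: bit) = 1" by auto
    qed
    also have "\<dots> = 0" using * by (simp add: card_Diff_singleton)
    finally show "b t k t' k' = b t' k' t k"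
      by (cases "b t k t' k'"; cases "b t' k' t k") auto
  next
    fix t t' k' assume *: "t \<in> T" "t' \<in> T" "t \<noteq> t'" "k' \<in> {..<3::nat}"
    \<comment> \<open>Each index survives two of the three possible deletions, so its term occurs
      twice.\<close>
    have "(\<Sum>k\<in>{..<3}. \<Sum>a\<in>{..<3} - {k}. h a) = (0::bit)" for h :: "nat \<Rightarrow> bit"
    proof -
      have "{0, 1, 2} - {0} = {1, 2::nat}" "{0, 1, 2} - {1} = {0, 2::nat}" "{0, 1, 2} - {2} = {0, 1::nat}"
        by auto
      then have "(\<Sum>k\<in>{..<3}. \<Sum>a\<in>{..<3} - {k}. h a) = (h 1 + h 2) + ((h 0 + h 2) + (h 0 + h 1))"
        by (simp add: lessThan_3)
      also have "\<dots> = (h 0 + h 0) + (h 1 + h 1) + (h 2 + h 2)" by (simp only: ac_simps)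
      finally show ?thesis by simp
    qed
    then show "(\<Sum>k\<in>{..<3}. b t k t' k') = 0" by (simp add: b_def)
  qed (use finite_T in auto)
  also have "\<dots> = (\<Sum>\<zeta>\<in>PiE T (\<lambda>_. {..<3}). of_bool (\<zeta> \<in> balanced))"
  proof (rule sum.cong[OF refl])
    fix \<zeta> assume \<zeta>: "\<zeta> \<in> PiE T (\<lambda>_. {..<3::nat})"
    show "(\<Prod>t\<in>T. 1 + (\<Sum>t'\<in>T - {t}. b t (\<zeta> t) t' (\<zeta> t'))) = of_bool (\<zeta> \<in> balanced)"
    proof (cases "\<zeta> \<in> balanced")
      case True
      then show ?thesis using ind[OF \<zeta>] by (simp add: balanced_def)
    next
      case False
      then obtain t where "t \<in> T" "(\<Sum>a\<in>{..<3} - {\<zeta> t}. rank \<zeta> (q t a)) \<noteq> 1"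
        using \<zeta> by (auto simp: balanced_def)
      then have "\<exists>t\<in>T. 1 + (\<Sum>t'\<in>T - {t}. b t (\<zeta> t) t' (\<zeta> t')) = 0"
        using ind[OF \<zeta>] by (intro bexI[of _ t]) auto
      then show ?thesis using False finite_T by (simp add: prod_zero)
    qed
  qed
  also have "\<dots> = of_nat (card balanced)"
  proof -
    have "finite (PiE T (\<lambda>_. {..<3::nat}))" using finite_T by (simp add: finite_PiE)
    moreover have "{\<zeta> \<in> PiE T (\<lambda>_. {..<3}). \<zeta> \<in> balanced} = balanced" by (auto simp: balanced_def)
    ultimately show ?thesis by (simp add: of_bool_def sum.If_cases Int_def)
  qed
  finally show ?thesis by (metis even_of_nat odd_one)
qed

text \<open>By \<open>sum_gf4_rainbows_monomial\<close> these are the choices \<open>B\<close> whose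
  monomials survive the summation over all rainbow colourings: every triple carries the exponents
  \<open>0\<close>, \<open>1\<close>, \<open>2\<close>.\<close>

definition exponents_ok :: "nat set set" where
  "exponents_ok = {B. B \<subseteq> {..<n - 1} \<and> (\<forall>t\<in>T. inj_on (\<lambda>k. path_exponent B (q t k)) {..<3})}"

definition rank_set :: "('t \<Rightarrow> nat) \<Rightarrow> nat set" where
  "rank_set \<zeta> = {i. i < n \<and> rank \<zeta> i = 1}"

lemma rank_0:
  assumes "\<zeta> \<in> PiE T (\<lambda>_. {..<3})" "t \<in> T" "k < 3" "q t k = 0"
  shows "rank \<zeta> 0 = of_bool (k \<noteq> \<zeta> t)"
proof -
  have "(\<Sum>k'\<in>{..<3} - {\<zeta> t'}. of_bool (q t' k' \<le> 0)) = (of_bool (t' = t \<and> k \<noteq> \<zeta> t) :: bit)"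
    if "t' \<in> T" for t'
  proof -
    have "(\<Sum>k'\<in>{..<3} - {\<zeta> t'}. of_bool (q t' k' \<le> 0))
        = (\<Sum>k'\<in>{..<3} - {\<zeta> t'}. if k' = k then of_bool (t' = t) else (0::bit))"
    proof (rule sum.cong[OF refl])
      fix k' assume "k' \<in> {..<3} - {\<zeta> t'}"
      then show "of_bool (q t' k' \<le> 0) = (if k' = k then of_bool (t' = t) else (0::bit))"
        using q_eq_iff[of t' k' t k] assms that by auto
    qed
    then show ?thesis using assms by auto
  qed
  then have "rank \<zeta> 0 = (\<Sum>t'\<in>T. if t' = t then of_bool (k \<noteq> \<zeta> t) else 0)"
    unfolding rank_def by (intro sum.cong) auto
  then show ?thesis using finite_T assms by simp
qed

lemma rank_Suc:
  assumes "\<zeta> \<in> PiE T (\<lambda>_. {..<3})" "t \<in> T" "k < 3" "q t k = Suc i"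
  shows "rank \<zeta> (Suc i) = rank \<zeta> i + of_bool (k \<noteq> \<zeta> t)"
proof -
  have "(\<Sum>k'\<in>{..<3} - {\<zeta> t'}. of_bool (q t' k' \<le> Suc i))
      = (\<Sum>k'\<in>{..<3} - {\<zeta> t'}. of_bool (q t' k' \<le> i)) + (of_bool (t' = t \<and> k \<noteq> \<zeta> t) :: bit)"
    if "t' \<in> T" for t'
  proof -
    have "(\<Sum>k'\<in>{..<3} - {\<zeta> t'}. of_bool (q t' k' \<le> Suc i))
        = (\<Sum>k'\<in>{..<3} - {\<zeta> t'}. of_bool (q t' k' \<le> i) + (if k' = k then of_bool (t' = t) else (0::bit)))"
    proof (rule sum.cong[OF refl])
      fix k' assume "k' \<in> {..<3} - {\<zeta> t'}"
      then have "q t' k' = Suc i \<longleftrightarrow> t' = t \<and> k' = k" using q_eq_iff[of t' k' t k] assms that by auto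
      then show "of_bool (q t' k' \<le> Suc i)
          = of_bool (q t' k' \<le> i) + (if k' = k then of_bool (t' = t) else (0::bit))"
        by (auto simp: le_Suc_eq)
    qed
    then show ?thesis using assms by (auto simp: sum.distrib)
  qed
  then have "rank \<zeta> (Suc i) = rank \<zeta> i + (\<Sum>t'\<in>T. if t' = t then of_bool (k \<noteq> \<zeta> t) else 0)"
    unfolding rank_def sum.distrib[symmetric]
    by (intro sum.cong) (simp_all del: sum_of_bool_eq)
  then show ?thesis using finite_T assms by simp
qed

text \<open>Two points of each triple are kept, so their total number is even. Hence
  \<open>rank_set \<zeta>\<close> avoids \<open>n - 1\<close>, the position that is not the left end
  of an edge.\<close>

lemma rank_last:
  assumes "\<zeta> \<in> PiE T (\<lambda>_. {..<3})"
  shows "rank \<zeta> (n - 1) = 0"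
proof -
  have "(\<Sum>k\<in>{..<3} - {\<zeta> t}. of_bool (q t k \<le> n - 1)) = (0::bit)" if t: "t \<in> T" for t
  proof -
    have "(\<Sum>k\<in>{..<3} - {\<zeta> t}. of_bool (q t k \<le> n - 1)) = (\<Sum>k\<in>{..<3} - {\<zeta> t}. 1::bit)"
    proof (rule sum.cong[OF refl])
      fix k assume "k \<in> {..<3} - {\<zeta> t}"
      then have "q t k < n" using q_less[OF t] by simp
      then show "of_bool (q t k \<le> n - 1) = (1::bit)" by simp
    qed
    moreover have "\<zeta> t < 3" using assms t by auto
    ultimately show ?thesis by (simp add: card_Diff_singleton)
  qed
  then show ?thesis by (simp add: rank_def)
qed

text \<open>The rank changes exactly at the kept points. At a deleted point membership in
  \<open>rank_set \<zeta>\<close> agrees with that of the previous position, which gives exponent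
  \<open>1\<close>; at a kept point it flips, which gives \<open>2\<close> on entering the set and
  \<open>0\<close> on leaving it. Before position \<open>0\<close> the rank counts as
  \<open>0\<close>.\<close>

lemma path_exponent_rank_set:
  assumes \<zeta>: "\<zeta> \<in> PiE T (\<lambda>_. {..<3})" and t: "t \<in> T" and k: "k < 3"
  shows "path_exponent (rank_set \<zeta>) (q t k)
      = (if k = \<zeta> t then 1 else if rank \<zeta> (q t k) = 1 then 2 else 0)"
proof (cases "q t k")
  case 0
  then show ?thesis using rank_0[OF \<zeta> t k] q_less[OF t k]
    by (auto simp: path_exponent_def rank_set_def)
next
  case (Suc i)
  then show ?thesis using rank_Suc[OF \<zeta> t k Suc] q_less[OF t k]
    by (cases "rank \<zeta> i") (auto simp: path_exponent_def rank_set_def)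
qed

lemma inj_on_exponents_iff:
  assumes \<zeta>: "\<zeta> \<in> PiE T (\<lambda>_. {..<3})" and t: "t \<in> T"
  shows "inj_on (\<lambda>k. path_exponent (rank_set \<zeta>) (q t k)) {..<3}
     \<longleftrightarrow> (\<Sum>a\<in>{..<3} - {\<zeta> t}. rank \<zeta> (q t a)) = 1"
proof -
  have "\<zeta> t < 3" using \<zeta> t by auto
  then obtain a b where a: "{..<3} - {\<zeta> t} = {a, b}" "a \<noteq> b" "{..<3} = {\<zeta> t, a, b}" "a \<noteq> \<zeta> t" "b \<noteq> \<zeta> t"
    by (rule lessThan_3_minus)
  then have "a < 3" "b < 3" by auto
  note E = path_exponent_rank_set[OF \<zeta> t \<open>\<zeta> t < 3\<close>]
    path_exponent_rank_set[OF \<zeta> t \<open>a < 3\<close>] path_exponent_rank_set[OF \<zeta> t \<open>b < 3\<close>]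
  show ?thesis unfolding a(1) a(3) using a(2,4,5)
    by (cases "rank \<zeta> (q t a)"; cases "rank \<zeta> (q t b)") (auto simp: E inj_on_def)
qed

text \<open>The deleted point of a triple can be read off as its unique point of exponent
  \<open>1\<close>; it exists because three distinct exponents at most \<open>2\<close> exhaust
  \<open>0\<close>, \<open>1\<close>, \<open>2\<close>.\<close>

lemma bij_betw_balanced: "bij_betw rank_set balanced exponents_ok"
proof (rule bij_betw_imageI)
  show "inj_on rank_set balanced"
  proof
    fix \<zeta> \<zeta>' assume *: "\<zeta> \<in> balanced" "\<zeta>' \<in> balanced" "rank_set \<zeta> = rank_set \<zeta>'"
    then have \<zeta>: "\<zeta> \<in> PiE T (\<lambda>_. {..<3})" "\<zeta>' \<in> PiE T (\<lambda>_. {..<3})" by (auto simp: balanced_def)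
    show "\<zeta> = \<zeta>'"
    proof (rule PiE_ext[OF \<zeta>])
      fix t assume t: "t \<in> T"
      then have "\<zeta> t < 3" using \<zeta> by auto
      have "(if \<zeta> t = \<zeta>' t then 1 else if rank \<zeta>' (q t (\<zeta> t)) = 1 then 2 else 0) = (1::nat)"
        unfolding path_exponent_rank_set[OF \<zeta>(2) t \<open>\<zeta> t < 3\<close>, symmetric] *(3)[symmetric]
        using path_exponent_rank_set[OF \<zeta>(1) t \<open>\<zeta> t < 3\<close>] by simp
      then show "\<zeta> t = \<zeta>' t" by (simp split: if_splits)
    qed
  qed
  show "rank_set ` balanced = exponents_ok"
  proof
    show "rank_set ` balanced \<subseteq> exponents_ok"
    proof
      fix B assume "B \<in> rank_set ` balanced"
      then obtain \<zeta> where \<zeta>: "\<zeta> \<in> balanced" "B = rank_set \<zeta>" by auto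
      then have Z: "\<zeta> \<in> PiE T (\<lambda>_. {..<3})" by (simp add: balanced_def)
      have "i < n - 1" if "i \<in> rank_set \<zeta>" for i
        using that rank_last[OF Z] by (cases "i = n - 1") (auto simp: rank_set_def)
      then show "B \<in> exponents_ok"
        using \<zeta> inj_on_exponents_iff[OF Z] by (auto simp: exponents_ok_def balanced_def)
    qed
    show "exponents_ok \<subseteq> rank_set ` balanced"
    proof
      fix B assume "B \<in> exponents_ok"
      then have B: "B \<subseteq> {..<n - 1}" and inj: "\<And>t. t \<in> T \<Longrightarrow> inj_on (\<lambda>k. path_exponent B (q t k)) {..<3}"
        by (auto simp: exponents_ok_def)
      have ex: "\<exists>k<3. path_exponent B (q t k) = 1" if t: "t \<in> T" for t
      proof -
        have "(\<lambda>k. path_exponent B (q t k)) ` {..<3} \<subseteq> {..<3}"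
          using le_less_trans[OF path_exponent_le, of 3 B] by auto
        then have "(\<lambda>k. path_exponent B (q t k)) ` {..<3} = {..<3}"
          using inj[OF t] by (intro card_subset_eq) (auto simp: card_image)
        moreover have "(1::nat) \<in> {..<3}" by simp
        ultimately show ?thesis by (metis (no_types, lifting) image_iff lessThan_iff)
      qed
      define \<zeta> where "\<zeta> = restrict (\<lambda>t. SOME k. k < 3 \<and> path_exponent B (q t k) = 1) T"
      have \<zeta>1: "\<zeta> t < 3 \<and> path_exponent B (q t (\<zeta> t)) = 1" if "t \<in> T" for t
        using someI_ex[OF ex[OF that]] that by (simp add: \<zeta>_def)
      then have Z: "\<zeta> \<in> PiE T (\<lambda>_. {..<3})" by (auto simp: \<zeta>_def)
      have eq1: "path_exponent B (q t k) = 1 \<longleftrightarrow> k = \<zeta> t" if "t \<in> T" "k < 3" for t k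
        using \<zeta>1[OF that(1)] inj[OF that(1)] that by (auto simp: inj_on_def)
      \<comment> \<open>Along the path, membership in \<open>B\<close> flips exactly at the points
        of exponent other than \<open>1\<close>, which is the recursion satisfied by the
        rank.\<close>
      have mem: "rank \<zeta> i = 1 \<longleftrightarrow> i \<in> B" if "i < n" for i
        using that
      proof (induction i)
        case 0
        then obtain t k where tk: "t \<in> T" "k < 3" "0 = q t k" by (rule q_surj)
        then have "rank \<zeta> 0 = of_bool (k \<noteq> \<zeta> t)" by (intro rank_0[OF Z]) auto
        moreover have "k = \<zeta> t \<longleftrightarrow> 0 \<notin> B" using eq1[OF tk(1,2)] tk(3) by (auto simp: path_exponent_def)
        ultimately show ?case by auto
      next
        case (Suc i)
        then obtain t k where tk: "t \<in> T" "k < 3" "Suc i = q t k" by (elim q_surj)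
        then have "rank \<zeta> (Suc i) = rank \<zeta> i + of_bool (k \<noteq> \<zeta> t)" by (intro rank_Suc[OF Z]) auto
        moreover have "k = \<zeta> t \<longleftrightarrow> (Suc i \<in> B \<longleftrightarrow> i \<in> B)"
          using eq1[OF tk(1,2)] tk(3)[symmetric]
          by (cases "Suc i \<in> B"; cases "i \<in> B") (auto simp: path_exponent_def)
        ultimately show ?case using Suc by (cases "rank \<zeta> i") auto
      qed
      have BR: "B = rank_set \<zeta>" using mem B by (auto simp: rank_set_def)
      moreover have "\<zeta> \<in> balanced"
        using inj inj_on_exponents_iff[OF Z] Z by (auto simp: balanced_def BR)
      ultimately show "B \<in> rank_set ` balanced" by auto
    qed
  qed
qed

theorem path_plus_triangles:
  obtains x :: "nat \<Rightarrow> gf4" where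
    "\<And>i. Suc i < n \<Longrightarrow> x i \<noteq> x (Suc i)"
    "\<And>t k k'. \<lbrakk>t \<in> T; k < 3; k' < 3; k \<noteq> k'\<rbrakk> \<Longrightarrow> x (q t k) \<noteq> x (q t k')"
    "\<And>i. i < n \<Longrightarrow> x i \<noteq> 0"
proof (cases "n = 0")
  case True
  then have "T = {}" using q_less[of _ 0] by fastforce
  then show ?thesis using that[of "\<lambda>_. 1"] True by auto
next
  case False
  \<comment> \<open>\<open>r\<close> inverts \<open>q\<close>, so that a choice
    \<open>\<phi>\<close> of a rainbow for every triple becomes a colouring \<open>x \<phi>\<close>
    of the positions.\<close>
  define r where "r = inv_into (T \<times> {..<3}) (\<lambda>(t, k). q t k)"
  define x where "x \<phi> i = (\<phi> (fst (r i)) ! snd (r i) :: gf4)" for \<phi> i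
  let ?\<Phi> = "PiE T (\<lambda>_. gf4_rainbows)"
  have r: "r (q t k) = (t, k)" if "t \<in> T" "k < 3" for t k
    using inv_into_f_f[of "\<lambda>(t, k). q t k" "T \<times> {..<3}" "(t, k)"] bij_q that
    by (auto simp: r_def bij_betw_def)
  have xq: "x \<phi> (q t k) = \<phi> t ! k" if "t \<in> T" "k < 3" for \<phi> t k
    using that by (simp add: x_def r)
  \<comment> \<open>The leading factor raises the degree from \<open>n - 1\<close> to
    \<open>n\<close>, as needed for exponents \<open>0\<close>, \<open>1\<close>, \<open>2\<close>
    on each of the \<open>n / 3\<close> triples.\<close>
  have "(\<Sum>\<phi>\<in>?\<Phi>. x \<phi> 0 * (\<Prod>i<n - 1. x \<phi> i + x \<phi> (Suc i)))
      = (\<Sum>\<phi>\<in>?\<Phi>. \<Sum>B\<in>Pow {..<n - 1}. \<Prod>i<n. x \<phi> i ^ path_exponent B i)"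
    using False by (simp add: path_product_expand)
  also have "\<dots> = (\<Sum>B\<in>Pow {..<n - 1}. \<Sum>\<phi>\<in>?\<Phi>. \<Prod>i<n. x \<phi> i ^ path_exponent B i)"
    by (rule sum.swap)
  also have "\<dots> = (\<Sum>B\<in>Pow {..<n - 1}. of_bool (B \<in> exponents_ok))"
  proof (rule sum.cong[OF refl])
    fix B assume B: "B \<in> Pow {..<n - 1}"
    have "(\<Sum>\<phi>\<in>?\<Phi>. \<Prod>i<n. x \<phi> i ^ path_exponent B i)
        = (\<Sum>\<phi>\<in>?\<Phi>. \<Prod>t\<in>T. \<Prod>k<3. (\<phi> t ! k) ^ path_exponent B (q t k))"
    proof (rule sum.cong[OF refl])
      fix \<phi>
      have "(\<Prod>i<n. x \<phi> i ^ path_exponent B i)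
          = (\<Prod>(t, k)\<in>T \<times> {..<3}. x \<phi> (q t k) ^ path_exponent B (q t k))"
        by (subst prod.reindex_bij_betw[OF bij_q, symmetric]) (simp add: case_prod_unfold)
      also have "\<dots> = (\<Prod>t\<in>T. \<Prod>k<3. x \<phi> (q t k) ^ path_exponent B (q t k))"
        by (rule prod.cartesian_product[symmetric])
      also have "\<dots> = (\<Prod>t\<in>T. \<Prod>k<3. (\<phi> t ! k) ^ path_exponent B (q t k))"
        by (intro prod.cong refl) (simp add: xq)
      finally show "(\<Prod>i<n. x \<phi> i ^ path_exponent B i)
          = (\<Prod>t\<in>T. \<Prod>k<3. (\<phi> t ! k) ^ path_exponent B (q t k))" .
    qed
    \<comment> \<open>The rainbows of different triples are chosen independently, so the sum of a
      monomial factors over the triples.\<close>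
    also have "\<dots> = (\<Prod>t\<in>T. \<Sum>p\<in>gf4_rainbows. \<Prod>k<3. (p ! k) ^ path_exponent B (q t k))"
      by (rule prod_sum_PiE[symmetric]) (use finite_T in \<open>auto simp: gf4_rainbows_def\<close>)
    also have "\<dots> = (\<Prod>t\<in>T. of_bool (inj_on (\<lambda>k. path_exponent B (q t k)) {..<3}))"
      by (intro prod.cong refl sum_gf4_rainbows_monomial path_exponent_le)
    also have "\<dots> = of_bool (B \<in> exponents_ok)"
      using B finite_T by (auto simp: exponents_ok_def intro!: prod_zero prod.neutral)
    finally show "(\<Sum>\<phi>\<in>?\<Phi>. \<Prod>i<n. x \<phi> i ^ path_exponent B i) = of_bool (B \<in> exponents_ok)" .
  qed
  also have "\<dots> = of_nat (card exponents_ok)"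
  proof -
    have "{B \<in> Pow {..<n - 1}. B \<in> exponents_ok} = exponents_ok" by (auto simp: exponents_ok_def)
    then show ?thesis by (simp add: of_bool_def sum.If_cases Int_def)
  qed
  also have "\<dots> = 1"
    using odd_card_balanced bij_betw_same_card[OF bij_betw_balanced] by (simp add: of_nat_gf4_odd)
  finally have "(\<Sum>\<phi>\<in>?\<Phi>. x \<phi> 0 * (\<Prod>i<n - 1. x \<phi> i + x \<phi> (Suc i))) \<noteq> 0" by simp
  \<comment> \<open>Some summand is nonzero, hence all its factors are; in characteristic 2 the sum
    \<open>x \<phi> i + x \<phi> (Suc i)\<close> vanishes if its terms are equal.\<close>
  then obtain \<phi> where \<phi>: "\<phi> \<in> ?\<Phi>" "x \<phi> 0 * (\<Prod>i<n - 1. x \<phi> i + x \<phi> (Suc i)) \<noteq> 0"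
    by (metis (no_types, lifting) sum.neutral)
  have rb: "\<phi> t \<in> gf4_rainbows" if "t \<in> T" for t using \<phi> that by auto
  show ?thesis
  proof (rule that[of "x \<phi>"])
    fix i assume i: "Suc i < n"
    show "x \<phi> i \<noteq> x \<phi> (Suc i)"
    proof
      assume "x \<phi> i = x \<phi> (Suc i)"
      then have "\<exists>i\<in>{..<n - 1}. x \<phi> i + x \<phi> (Suc i) = 0" using i by (intro bexI[of _ i]) auto
      then have "(\<Prod>i<n - 1. x \<phi> i + x \<phi> (Suc i)) = 0" by (intro prod_zero) auto
      then show False using \<phi> by simp
    qed
  next
    fix t k k' assume *: "t \<in> T" "k < 3" "k' < 3" "k \<noteq> (k'::nat)"
    then show "x \<phi> (q t k) \<noteq> x \<phi> (q t k')"
      using rb[OF *(1)] less_3_cases[OF *(2)] less_3_cases[OF *(3)]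
      by (auto simp: xq gf4_rainbows_def)
  next
    fix i assume "i < n"
    then obtain t k where tk: "t \<in> T" "k < 3" "i = q t k" by (rule q_surj)
    then show "x \<phi> i \<noteq> 0"
      using rb[OF tk(1)] less_3_cases[OF tk(2)] by (auto simp: xq gf4_rainbows_def zero_gf4_def)
  qed
qed

end

section \<open>Splitting, transversals and matchings\<close>

text \<open>One notion for partition classes and for graphs: fibres of size at most \<open>2\<close>
  are the edges and isolated points of a matching.\<close>

definition fibres_le :: "'a set \<Rightarrow> ('a \<Rightarrow> 'b) \<Rightarrow> nat \<Rightarrow> bool" where
  "fibres_le D f m \<longleftrightarrow> finite D \<and> (\<forall>v. card {x \<in> D. f x = v} \<le> m)"

lemma fibres_leD: "fibres_le D f m \<Longrightarrow> card {x \<in> D. f x = v} \<le> m"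
  by (simp add: fibres_le_def)

lemma fibres_le_subset: "fibres_le D f m \<Longrightarrow> D' \<subseteq> D \<Longrightarrow> fibres_le D' f m"
  unfolding fibres_le_def
proof (intro conjI allI)
  fix v assume *: "finite D \<and> (\<forall>v. card {x \<in> D. f x = v} \<le> m)" "D' \<subseteq> D"
  then have "card {x \<in> D'. f x = v} \<le> card {x \<in> D. f x = v}" by (intro card_mono) auto
  then show "card {x \<in> D'. f x = v} \<le> m" using * le_trans by blast
qed (auto intro: finite_subset)

lemma fibre_subset_card_le:
  assumes "fibres_le D f m" "X \<subseteq> D" "\<And>x. x \<in> X \<Longrightarrow> f x = v"
  shows "card X \<le> m"
proof -
  have "card X \<le> card {x \<in> D. f x = v}"
    using assms by (intro card_mono) (auto simp: fibres_le_def)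
  then show ?thesis using fibres_leD[OF assms(1), of v] by linarith
qed

lemma fibres_le_2D:
  assumes "fibres_le D f 2" "x \<in> D" "y \<in> D" "z \<in> D" "f x = f y" "f x = f z"
  shows "x = y \<or> x = z \<or> y = z"
proof (rule ccontr)
  assume "\<not> ?thesis"
  then have "card {x, y, z} = 3" by auto
  moreover have "card {x, y, z} \<le> 2"
    by (rule fibre_subset_card_le[OF assms(1), of _ "f x"]) (use assms in auto)
  ultimately show False by simp
qed

lemma fibres_le_2I:
  assumes "finite D" "\<And>x y z. \<lbrakk>x \<in> D; y \<in> D; z \<in> D; f x = f y; f x = f z\<rbrakk> \<Longrightarrow> x = y \<or> x = z \<or> y = z"
  shows "fibres_le D f 2"
  unfolding fibres_le_def
proof (intro conjI allI, rule assms(1), rule ccontr)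
  fix v assume "\<not> card {x \<in> D. f x = v} \<le> 2"
  then have "3 \<le> card {x \<in> D. f x = v}" by simp
  then obtain X where "X \<subseteq> {x \<in> D. f x = v}" "card X = 3"
    by (rule obtain_subset_with_card_n)
  then obtain x y z where "{x, y, z} \<subseteq> {x \<in> D. f x = v}" "x \<noteq> y" "x \<noteq> z" "y \<noteq> z"
    unfolding card_3_iff by blast
  then show False using assms(2)[of x y z] by auto
qed

text \<open>A graph that is the union of two matchings is bipartite. In the induction step an \<open>f\<close>-fibre
  \<open>{x, y}\<close> is removed and the \<open>g\<close>-fibres of \<open>x\<close> and \<open>y\<close> are merged.\<close>

lemma split_fibres:
  assumes "fibres_le D f 2" "fibres_le D g 2"
  shows "\<exists>S. \<forall>x\<in>D. \<forall>y\<in>D. x \<noteq> y \<longrightarrow> f x = f y \<or> g x = g y \<longrightarrow> (x \<in> S) \<noteq> (y \<in> S)"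
  using assms
proof (induction "card D" arbitrary: D g rule: less_induct)
  case less
  note f3 = fibres_le_2D[OF less.prems(1)] and g3 = fibres_le_2D[OF less.prems(2)]
  have fin: "finite D" using less.prems by (simp add: fibres_le_def)
  show ?case
  proof (cases "inj_on f D")
    case True
    \<comment> \<open>All \<open>f\<close>-fibres are single points here, so it suffices to put one
      representative of each \<open>g\<close>-fibre into the set.\<close>
    define r where "r x = (SOME y. y \<in> D \<and> g y = g x)" for x
    have r: "r x \<in> D \<and> g (r x) = g x" if "x \<in> D" for x
      unfolding r_def by (rule someI[of _ x]) (use that in auto)
    have "(x \<in> {x. r x = x}) \<noteq> (y \<in> {x. r x = x})" if "x \<in> D" "y \<in> D" "x \<noteq> y" "g x = g y" for x y
    proof -
      have "r x = r y" using that by (simp add: r_def)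
      then show ?thesis using g3[of x y "r x"] r[of x] that by auto
    qed
    then show ?thesis using inj_onD[OF True] by (intro exI[of _ "{x. r x = x}"] ballI impI) blast
  next
    case False
    then obtain x y where xy: "x \<in> D" "y \<in> D" "x \<noteq> y" "f x = f y" by (auto simp: inj_on_def)
    define D' where "D' = D - {x, y}"
    define g' where "g' p = (if g p = g y then g x else g p)" for p
    have "card D' < card D" unfolding D'_def using fin xy by (intro psubset_card_mono) auto
    moreover have "fibres_le D' f 2" using less.prems(1) by (rule fibres_le_subset) (auto simp: D'_def)
    \<comment> \<open>The \<open>g\<close>-fibres of \<open>x\<close> and \<open>y\<close> each lose
      a point, so each has at most one point left to put into the merged fibre.\<close>
    moreover have "fibres_le D' g' 2"
    proof (rule fibres_le_2I)
      show "finite D'" using fin by (simp add: D'_def)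
      fix a b c assume *: "a \<in> D'" "b \<in> D'" "c \<in> D'" "g' a = g' b" "g' a = g' c"
      have D'D: "p \<in> D \<and> p \<noteq> x \<and> p \<noteq> y" if "p \<in> D'" for p using that by (simp add: D'_def)
      have x2: "p = q" if "p \<in> D'" "q \<in> D'" "g p = g x" "g q = g x" for p q
        using g3[of x p q] that xy D'D by metis
      have y2: "p = q" if "p \<in> D'" "q \<in> D'" "g p = g y" "g q = g y" for p q
        using g3[of y p q] that xy D'D by metis
      show "a = b \<or> a = c \<or> b = c"
      proof (cases "g' a = g x")
        case True
        then have "g a = g x \<or> g a = g y" "g b = g x \<or> g b = g y" "g c = g x \<or> g c = g y"
          using *(4,5) by (simp_all add: g'_def split: if_splits)
        then show ?thesis using x2 y2 *(1-3) by metis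
      next
        case False
        then have "g a = g b" "g a = g c" using *(4,5) unfolding g'_def by metis+
        then show ?thesis using g3[of a b c] *(1-3) D'D by blast
      qed
    qed
    ultimately obtain S where S:
      "\<And>p q. \<lbrakk>p \<in> D'; q \<in> D'; p \<noteq> q; f p = f q \<or> g' p = g' q\<rbrakk> \<Longrightarrow> (p \<in> S) \<noteq> (q \<in> S)"
      using less.hyps[of D' g'] by meson
    \<comment> \<open>\<open>b\<close> is the side of \<open>x\<close>, and \<open>y\<close> gets
      the other side. A remaining \<open>g\<close>-partner of \<open>x\<close> or of
      \<open>y\<close> dictates it; two such partners agree because the merged fibre puts them on
      different sides.\<close>
    define b where "b \<longleftrightarrow> (\<exists>p\<in>D'. g p = g x \<and> p \<notin> S) \<or> (\<exists>q\<in>D'. g q = g y \<and> q \<in> S)"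
    define S' where "S' = (S \<inter> D') \<union> (if b then {x} else {y})"
    have D'D: "p \<in> D \<and> p \<noteq> x \<and> p \<noteq> y" if "p \<in> D'" for p using that by (auto simp: D'_def)
    have px: "(p \<in> S) \<noteq> b" if p: "p \<in> D'" "g p = g x" for p
    proof (cases "p \<in> S")
      case False then show ?thesis using p by (auto simp: b_def)
    next
      case True
      have "\<not> b"
      proof
        assume b
        then consider p' where "p' \<in> D'" "g p' = g x" "p' \<notin> S" | q where "q \<in> D'" "g q = g y" "q \<in> S"
          unfolding b_def by blast
        then show False
        proof cases
          case 1
          then show False using g3[of x p p'] p True D'D xy by metis
        next
          case 2
          then have "g' p = g' q" using p by (auto simp: g'_def)
          then have "p = q" using S[of p q] 2 p True by auto
          then show False using g3[of x y p] p 2 D'D[of p] xy by metis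
        qed
      qed
      then show ?thesis using True by simp
    qed
    have py: "(p \<in> S) = b" if p: "p \<in> D'" "g p = g y" for p
    proof (cases "p \<in> S")
      case True then show ?thesis using p by (auto simp: b_def)
    next
      case False
      have "\<not> b"
      proof
        assume b
        then consider p' where "p' \<in> D'" "g p' = g x" "p' \<notin> S" | q where "q \<in> D'" "g q = g y" "q \<in> S"
          unfolding b_def by blast
        then show False
        proof cases
          case 2
          then show False using g3[of y p q] p False D'D xy by metis
        next
          case 1
          then have "g' p = g' p'" using p by (auto simp: g'_def)
          then have "p = p'" using S[of p p'] 1 p False by auto
          then show False using g3[of x y p] p 1 D'D[of p] xy by metis
        qed
      qed
      then show ?thesis using False by simp
    qed
    have nf: "f p \<noteq> f x" if "p \<in> D'" for p using f3[of x y p] xy D'D[OF that] by metis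
    have memD': "p \<in> S' \<longleftrightarrow> p \<in> S" if "p \<in> D'" for p using that D'D[OF that] by (auto simp: S'_def)
    have mems: "x \<in> S' \<longleftrightarrow> b" "y \<in> S' \<longleftrightarrow> \<not> b" using xy by (auto simp: S'_def D'_def)
    have main: "(p \<in> S') \<noteq> (q \<in> S')"
      if pq: "p \<in> D" "q \<in> D" "p \<noteq> q" "f p = f q \<or> g p = g q" for p q
    proof -
      consider "p \<in> D'" "q \<in> D'" | "p = x" "q = y" | "p = y" "q = x" | "p = x" "q \<in> D'" | "p = y" "q \<in> D'"
        | "p \<in> D'" "q = x" | "p \<in> D'" "q = y"
        using pq unfolding D'_def by blast
      then show ?thesis
      proof cases
        case 1
        moreover have "f p = f q \<or> g' p = g' q" using that by (auto simp: g'_def)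
        ultimately show ?thesis using S[of p q] that memD' by auto
      next
        case 4 then show ?thesis using that nf[of q] px[of q] memD' mems by auto
      next
        case 5 then show ?thesis using that nf[of q] py[of q] memD' mems xy by auto
      next
        case 6 then show ?thesis using that nf[of p] px[of p] memD' mems by auto
      next
        case 7 then show ?thesis using that nf[of p] py[of p] memD' mems xy by auto
      qed (use mems in auto)
    qed
    then show ?thesis by blast
  qed
qed

text \<open>Rado's proof: as long as some \<open>A i\<close> has two elements, one of them can be deleted without
  violating Hall's condition.\<close>

lemma hall:
  assumes "finite I" "\<And>i. i \<in> I \<Longrightarrow> finite (A i)" "\<And>J. J \<subseteq> I \<Longrightarrow> card J \<le> card (\<Union>i\<in>J. A i)"
  shows "\<exists>h. (\<forall>i\<in>I. h i \<in> A i) \<and> inj_on h I"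
  using assms
proof (induction "\<Sum>i\<in>I. card (A i)" arbitrary: A rule: less_induct)
  case less
  note fin = less.prems(1) and finA = less.prems(2) and hall = less.prems(3)
  have finU: "finite (\<Union>i\<in>J. A i)" if "J \<subseteq> I" for J
    using that fin finA by (meson finite_UN finite_subset subsetD)
  show ?case
  proof (cases "\<exists>i\<in>I. \<exists>x\<in>A i. \<exists>y\<in>A i. x \<noteq> y")
    case True
    then obtain i x y where i: "i \<in> I" and xy: "x \<in> A i" "y \<in> A i" "x \<noteq> y" by blast
    have step: ?thesis if z: "z \<in> A i" "\<And>J. J \<subseteq> I \<Longrightarrow> card J \<le> card (\<Union>j\<in>J. (A(i := A i - {z})) j)" for z
    proof -
      have "(\<Sum>j\<in>I. card ((A(i := A i - {z})) j)) < (\<Sum>j\<in>I. card (A j))"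
      proof (rule sum_strict_mono_ex1[OF fin])
        have *: "card (A i - {z}) < card (A i)" using finA[OF i] z(1) by (rule card_Diff1_less)
        then show "\<forall>j\<in>I. card ((A(i := A i - {z})) j) \<le> card (A j)" by simp
        show "\<exists>j\<in>I. card ((A(i := A i - {z})) j) < card (A j)" using * i by (intro bexI[of _ i]) simp_all
      qed
      then obtain h where h: "\<forall>j\<in>I. h j \<in> (A(i := A i - {z})) j" "inj_on h I"
        using less.hyps[OF _ fin _ z(2)] finA i by (metis finite_Diff fun_upd_apply)
      then have "\<forall>j\<in>I. h j \<in> A j" by (metis DiffD1 fun_upd_apply)
      then show ?thesis using h by blast
    qed
    have bad: "\<exists>J. J \<subseteq> I - {i} \<and> card ((\<Union>j\<in>J. A j) \<union> (A i - {z})) \<le> card J"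
      if viol: "\<not> (\<forall>J. J \<subseteq> I \<longrightarrow> card J \<le> card (\<Union>j\<in>J. (A(i := A i - {z})) j))" for z
    proof -
      obtain J where J: "J \<subseteq> I" "card (\<Union>j\<in>J. (A(i := A i - {z})) j) < card J" using viol not_le by blast
      have "i \<in> J"
      proof (rule ccontr)
        assume "i \<notin> J"
        then have "(\<Union>j\<in>J. (A(i := A i - {z})) j) = (\<Union>j\<in>J. A j)" by auto
        then show False using hall[OF J(1)] J(2) by simp
      qed
      then have "(\<Union>j\<in>J. (A(i := A i - {z})) j) = (\<Union>j\<in>J - {i}. A j) \<union> (A i - {z})" by auto
      moreover have "card J = Suc (card (J - {i}))"
        using \<open>i \<in> J\<close> J(1) fin by (metis card.remove finite_subset)
      ultimately show ?thesis using J by (intro exI[of _ "J - {i}"]) auto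
    qed
    show ?thesis
    proof (rule ccontr)
      assume no: "\<not> ?thesis"
      obtain J where J: "J \<subseteq> I - {i}" "card ((\<Union>j\<in>J. A j) \<union> (A i - {x})) \<le> card J"
        using bad[of x] step[of x] no xy by blast
      obtain K where K: "K \<subseteq> I - {i}" "card ((\<Union>j\<in>K. A j) \<union> (A i - {y})) \<le> card K"
        using bad[of y] step[of y] no xy by blast
      \<comment> \<open>Since \<open>x\<close> and \<open>y\<close> differ, \<open>?P\<close> and
        \<open>?Q\<close> together contain all of \<open>A i\<close>. Hall's condition for the union
        and the intersection of the two index sets then gives
        \<open>card ?P + card ?Q > card J + card K\<close>.\<close>
      let ?P = "(\<Union>j\<in>J. A j) \<union> (A i - {x})" and ?Q = "(\<Union>j\<in>K. A j) \<union> (A i - {y})"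
      have fPQ: "finite ?P" "finite ?Q" using J K finU[of J] finU[of K] finA[OF i] by auto
      have fJK: "finite J" "finite K" using J K fin by (auto intro: finite_subset)
      have PQ: "?P \<union> ?Q = (\<Union>j\<in>insert i (J \<union> K). A j)" using xy by auto
      have "insert i (J \<union> K) \<subseteq> I" using J(1) K(1) i by blast
      then have 1: "card (insert i (J \<union> K)) \<le> card (?P \<union> ?Q)" unfolding PQ by (rule hall)
      have 2: "card (J \<inter> K) \<le> card (?P \<inter> ?Q)"
      proof -
        have "card (J \<inter> K) \<le> card (\<Union>j\<in>J \<inter> K. A j)" using hall[of "J \<inter> K"] J by auto
        also have "\<dots> \<le> card (?P \<inter> ?Q)" using fPQ by (intro card_mono) auto
        finally show ?thesis .
      qed
      have "card ?P + card ?Q = card (?P \<union> ?Q) + card (?P \<inter> ?Q)" by (rule card_Un_Int[OF fPQ])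
      moreover have "card J + card K = card (J \<union> K) + card (J \<inter> K)" by (rule card_Un_Int[OF fJK])
      moreover have "card (insert i (J \<union> K)) = Suc (card (J \<union> K))"
        using J K fJK by (subst card_insert_disjoint) auto
      ultimately show False using 1 2 J(2) K(2) by linarith
    qed
  next
    case False
    have "\<exists>x. A i = {x}" if "i \<in> I" for i
    proof -
      have "card {i} \<le> card (A i)" using hall[of "{i}"] that by simp
      then have "A i \<noteq> {}" by auto
      then show ?thesis using False that by blast
    qed
    then obtain h where h: "\<And>i. i \<in> I \<Longrightarrow> A i = {h i}" by metis
    have "inj_on h I"
    proof
      fix i j assume ij: "i \<in> I" "j \<in> I" "h i = h j"
      then have "card {i, j} \<le> card {h i}" using hall[of "{i, j}"] h by auto
      then show "i = j" by (auto simp: card_insert_if split: if_splits)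
    qed
    then show ?thesis using h by auto
  qed
qed

text \<open>Hall's theorem for the sets of \<open>g\<close>-values on the \<open>f\<close>-fibres:
  the fibres over \<open>J\<close> contain at least \<open>d * card J\<close> points, and these need
  at least \<open>card J\<close> fibres of \<open>g\<close>.\<close>

lemma transversal_of_fibres:
  assumes "finite I" "0 < d" "fibres_le D g d" "\<And>i. i \<in> I \<Longrightarrow> d \<le> card {x \<in> D. f x = i}"
  shows "\<exists>h. (\<forall>i\<in>I. h i \<in> D \<and> f (h i) = i) \<and> inj_on (\<lambda>i. g (h i)) I"
proof -
  have fin: "finite D" using assms(3) by (simp add: fibres_le_def)
  define A where "A i = g ` {x \<in> D. f x = i}" for i
  have "\<exists>s. (\<forall>i\<in>I. s i \<in> A i) \<and> inj_on s I"
  proof (rule hall[OF assms(1)])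
    fix i show "finite (A i)" using fin by (simp add: A_def)
  next
    fix J assume J: "J \<subseteq> I"
    then have finJ: "finite J" using assms(1) finite_subset by blast
    let ?X = "{x \<in> D. f x \<in> J}"
    have "d * card J = (\<Sum>i\<in>J. d)" by simp
    also have "\<dots> \<le> (\<Sum>i\<in>J. card {x \<in> D. f x = i})" using J assms(4) by (intro sum_mono) auto
    also have "\<dots> = card (\<Union>i\<in>J. {x \<in> D. f x = i})"
      using finJ fin by (subst card_UN_disjoint) auto
    also have "(\<Union>i\<in>J. {x \<in> D. f x = i}) = ?X" by auto
    also have "card ?X \<le> card (\<Union>v\<in>g ` ?X. {x \<in> D. g x = v})"
      using fin by (intro card_mono) auto
    also have "\<dots> \<le> (\<Sum>v\<in>g ` ?X. card {x \<in> D. g x = v})" using fin by (intro card_UN_le) auto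
    also have "\<dots> \<le> (\<Sum>v\<in>g ` ?X. d)" by (intro sum_mono fibres_leD[OF assms(3)])
    also have "\<dots> = d * card (g ` ?X)" by simp
    also have "g ` ?X = (\<Union>i\<in>J. A i)" by (auto simp: A_def)
    finally show "card J \<le> card (\<Union>i\<in>J. A i)" using assms(2) by simp
  qed
  then obtain s where s: "\<forall>i\<in>I. s i \<in> A i" "inj_on s I" by blast
  have "\<exists>x. x \<in> D \<and> f x = i \<and> g x = s i" if "i \<in> I" for i
  proof -
    have "s i \<in> g ` {x \<in> D. f x = i}" using s(1) that by (simp add: A_def)
    then show ?thesis by auto
  qed
  then obtain h where h: "\<forall>i\<in>I. h i \<in> D \<and> f (h i) = i \<and> g (h i) = s i" by metis
  have "inj_on (\<lambda>i. g (h i)) I" using s(2) h by (simp add: inj_on_def)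
  then show ?thesis using h by blast
qed

lemma mendelsohn_dulmage:
  assumes "finite M1" "finite M2" "inj_on f M1" "inj_on g M1" "inj_on f M2" "inj_on g M2"
  obtains M where "M \<subseteq> M1 \<union> M2" "inj_on f M" "inj_on g M" "f ` M1 \<subseteq> f ` M" "g ` M2 \<subseteq> g ` M"
proof -
  define MM where "MM = {M. M \<subseteq> M1 \<union> M2 \<and> inj_on f M \<and> inj_on g M \<and> f ` M1 \<subseteq> f ` M}"
  have "finite MM" unfolding MM_def using assms(1,2) by (auto intro: finite_subset[of _ "Pow (M1 \<union> M2)"])
  moreover have "M1 \<in> MM" using assms by (simp add: MM_def)
  ultimately have fin: "finite ((\<lambda>M. card (M \<inter> M2)) ` MM)" "(\<lambda>M. card (M \<inter> M2)) ` MM \<noteq> {}" by auto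
  obtain M where M0: "M \<in> MM" "card (M \<inter> M2) = Max ((\<lambda>M. card (M \<inter> M2)) ` MM)"
    using Max_in[OF fin] by auto
  have M: "M \<in> MM" "\<And>M'. M' \<in> MM \<Longrightarrow> card (M' \<inter> M2) \<le> card (M \<inter> M2)"
    using M0 Max_ge[OF fin(1)] by auto
  have "g ` M2 \<subseteq> g ` M"
  proof (rule ccontr)
    assume "\<not> g ` M2 \<subseteq> g ` M"
    then obtain y where y: "y \<in> M2" "g y \<notin> g ` M" by blast
    define M' where "M' = insert y (M - {x. f x = f y})"
    have inj: "inj_on f M" "inj_on g M" using M(1) by (auto simp: MM_def)
    have yM: "y \<notin> M" using y by auto
    have "inj_on f M'" "inj_on g M'"
      unfolding M'_def using inj y(2) by (auto intro: inj_on_subset)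
    moreover have "f ` M \<subseteq> f ` M'" by (auto simp: M'_def)
    moreover have "M' \<subseteq> M1 \<union> M2" using M(1) y by (auto simp: MM_def M'_def)
    ultimately have "M' \<in> MM" using M(1) by (simp add: MM_def) (blast intro: subset_trans)
    moreover have "M' \<inter> M2 = insert y (M \<inter> M2)"
      using y assms(5) yM by (auto simp: M'_def dest: inj_onD)
    ultimately have "card (insert y (M \<inter> M2)) \<le> card (M \<inter> M2)" using M(2) by metis
    then show False using yM assms(2) by simp
  qed
  then show ?thesis using M(1) that[of M] by (simp add: MM_def)
qed

section \<open>Proper colourings and larger numbers of colours\<close>

definition proper_colouring ::
  "'a set \<Rightarrow> ('a \<Rightarrow> 'a \<Rightarrow> bool) \<Rightarrow> ('a \<Rightarrow> 'b) \<Rightarrow> nat \<Rightarrow> ('a \<Rightarrow> nat) \<Rightarrow> bool" where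
  "proper_colouring W adj c k col \<longleftrightarrow> (\<forall>x\<in>W. col x < k) \<and>
     (\<forall>x\<in>W. \<forall>y\<in>W. x \<noteq> y \<longrightarrow> adj x y \<or> c x = c y \<longrightarrow> col x \<noteq> col y)"

text \<open>If \<open>k\<close> colours suffice for fibres of size \<open>k\<close>, a colour class of a colouring of \<open>k\<close> points
  from each fibre of size \<open>k + 1\<close> meets each of these fibres, so it can be removed.\<close>

lemma proper_colouring_Suc:
  fixes adj :: "'a \<Rightarrow> 'a \<Rightarrow> bool"
  assumes "0 < k"
    and k: "\<And>W (c :: 'a \<Rightarrow> 'b). W \<subseteq> E \<Longrightarrow> fibres_le W c k \<Longrightarrow> \<exists>col. proper_colouring W adj c k col"
    and W: "W \<subseteq> E" and c: "fibres_le W (c :: 'a \<Rightarrow> 'b) (Suc k)"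
  shows "\<exists>col. proper_colouring W adj c (Suc k) col"
proof -
  have fin: "finite W" using c by (simp add: fibres_le_def)
  define big where "big = {v. card {x \<in> W. c x = v} = Suc k}"
  have "\<exists>X. X \<subseteq> {x \<in> W. c x = v} \<and> card X = k" if "v \<in> big" for v
  proof -
    have "k \<le> card {x \<in> W. c x = v}" using that by (simp add: big_def)
    then show ?thesis by (meson obtain_subset_with_card_n)
  qed
  then obtain X where X: "\<And>v. v \<in> big \<Longrightarrow> X v \<subseteq> {x \<in> W. c x = v} \<and> card (X v) = k" by metis
  define U where "U = (\<Union>v\<in>big. X v)"
  have UW: "U \<subseteq> W" using X by (auto simp: U_def)
  have UX: "{x \<in> U. c x = v} = (if v \<in> big then X v else {})" for v
    using X by (auto simp: U_def)
  have "fibres_le U c k"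
    unfolding fibres_le_def using fin UW X by (auto simp: UX intro: finite_subset)
  then obtain col1 where col1: "proper_colouring U adj c k col1" using k[of U c] UW W by auto
  define T where "T = {x \<in> U. col1 x = 0}"
  have hit: "\<exists>x\<in>T. c x = v" if v: "v \<in> big" for v
  proof -
    have XU: "x \<in> U" "c x = v" if "x \<in> X v" for x using that UX[of v] v by auto
    have "inj_on col1 (X v)"
      using col1 XU unfolding inj_on_def proper_colouring_def by metis
    moreover have "col1 ` X v \<subseteq> {..<k}" using col1 XU by (auto simp: proper_colouring_def)
    ultimately have "col1 ` X v = {..<k}"
      using X[OF v] by (intro card_subset_eq) (auto simp: card_image)
    then obtain x where "x \<in> X v" "col1 x = 0" using \<open>0 < k\<close> by (metis imageE lessThan_iff)
    then show ?thesis using XU by (auto simp: T_def)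
  qed
  have "fibres_le (W - T) c k"
    unfolding fibres_le_def
  proof (intro conjI allI)
    fix v
    have le: "card {x \<in> W. c x = v} \<le> Suc k" by (rule fibres_leD[OF c])
    show "card {x \<in> W - T. c x = v} \<le> k"
    proof (cases "v \<in> big")
      case True
      then obtain x where "x \<in> T" "c x = v" using hit by blast
      then have "{x \<in> W - T. c x = v} \<subset> {x \<in> W. c x = v}" using UW by (auto simp: T_def)
      then have "card {x \<in> W - T. c x = v} < card {x \<in> W. c x = v}"
        using fin by (intro psubset_card_mono) auto
      then show ?thesis using le by simp
    next
      case False
      have "card {x \<in> W - T. c x = v} \<le> card {x \<in> W. c x = v}" using fin by (intro card_mono) auto
      then show ?thesis using le False by (simp add: big_def)
    qed
  qed (use fin in simp)
  then obtain col2 where col2: "proper_colouring (W - T) adj c k col2" using k[of "W - T" c] W by auto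
  have TU: "x \<in> U" "col1 x = 0" if "x \<in> T" for x using that by (auto simp: T_def)
  have "proper_colouring W adj c (Suc k) (\<lambda>x. if x \<in> T then k else col2 x)"
    unfolding proper_colouring_def
  proof (intro conjI ballI impI)
    fix x assume "x \<in> W"
    then show "(if x \<in> T then k else col2 x) < Suc k"
      using col2 by (auto simp: proper_colouring_def less_Suc_eq)
  next
    fix x y assume *: "x \<in> W" "y \<in> W" "x \<noteq> y" "adj x y \<or> c x = c y"
    have "\<not> (x \<in> T \<and> y \<in> T)" using * TU[of x] TU[of y] col1 unfolding proper_colouring_def by metis
    moreover have "col2 x < k" if "x \<notin> T" using that col2 * by (auto simp: proper_colouring_def)
    moreover have "col2 y < k" if "y \<notin> T" using that col2 * by (auto simp: proper_colouring_def)
    moreover have "col2 x \<noteq> col2 y" if "x \<notin> T" "y \<notin> T"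
      using that col2 * by (auto simp: proper_colouring_def)
    ultimately show "(if x \<in> T then k else col2 x) \<noteq> (if y \<in> T then k else col2 y)" by auto
  qed
  then show ?thesis by blast
qed

section \<open>Colouring paths\<close>

text \<open>Points outside \<open>W\<close> are made into singleton classes, tagged by
  \<open>Inr\<close>; this is why the hypothesis is about classes labelled in a sum type.\<close>

lemma proper_colouring_on_subset:
  fixes adj :: "'a \<Rightarrow> 'a \<Rightarrow> bool" and c :: "'a \<Rightarrow> 'b"
  assumes "finite E" "0 < k"
    and all: "\<And>c' :: 'a \<Rightarrow> 'b + 'a. fibres_le E c' k \<Longrightarrow> \<exists>col. proper_colouring E adj c' k col"
    and "W \<subseteq> E" "fibres_le W c k"
  shows "\<exists>col. proper_colouring W adj c k col"
proof -
  define c' where "c' x = (if x \<in> W then Inl (c x) else Inr x)" for x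
  have "card {x \<in> E. c' x = v} \<le> k" for v
  proof (cases v)
    case (Inl u)
    then have "{x \<in> E. c' x = v} = {x \<in> W. c x = u}" using assms(4) by (auto simp: c'_def)
    then show ?thesis using fibres_leD[OF assms(5)] by simp
  next
    case (Inr u)
    then have "{x \<in> E. c' x = v} \<subseteq> {u}" by (auto simp: c'_def split: if_splits)
    then have "card {x \<in> E. c' x = v} \<le> card {u}" by (intro card_mono) auto
    then show ?thesis using assms(2) by simp
  qed
  then have "fibres_le E c' k" using assms(1) by (simp add: fibres_le_def)
  then obtain col where "proper_colouring E adj c' k col" using all by blast
  then have "proper_colouring W adj c k col"
    using assms(4) by (auto simp: proper_colouring_def c'_def subset_iff)
  then show ?thesis by blast
qed

text \<open>The induction on the number of colours has to treat all subsets of \<open>E\<close>,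
  because \<open>proper_colouring_Suc\<close> colours parts of the given set.\<close>

lemma proper_colouring_ge:
  fixes adj :: "'a \<Rightarrow> 'a \<Rightarrow> bool" and c :: "'a \<Rightarrow> 'b"
  assumes "finite E" "0 < k"
    and all: "\<And>c' :: 'a \<Rightarrow> 'b + 'a. fibres_le E c' k \<Longrightarrow> \<exists>col. proper_colouring E adj c' k col"
    and "k \<le> m" "fibres_le E c m"
  shows "\<exists>col. proper_colouring E adj c m col"
proof -
  have "\<exists>col. proper_colouring W adj c m col" if "W \<subseteq> E" "fibres_le W c m" for W and c :: "'a \<Rightarrow> 'b"
    using \<open>k \<le> m\<close> that
  proof (induction m arbitrary: W c rule: dec_induct)
    case base
    show ?case by (rule proper_colouring_on_subset[OF assms(1,2) all base])
  next
    case (step m)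
    have "0 < m" using \<open>0 < k\<close> step.hyps by simp
    then show ?case by (rule proper_colouring_Suc[OF _ step.IH step.prems])
  qed
  then show ?thesis using assms(5) by blast
qed

text \<open>Dummy entries fill up every class. They are appended at the end, so that the given
  entries keep their positions on the path.\<close>

lemma pad_to_multiplicity:
  assumes "\<And>t. count_list cs t \<le> k"
  obtains ds where "\<And>t. t \<in> set (cs @ ds) \<Longrightarrow> count_list (cs @ ds) t = k"
proof -
  obtain ds where ds: "mset ds = (\<Sum>t\<in>set cs. replicate_mset (k - count_list cs t) t)"
    using ex_mset by blast
  have count: "count_list ds t = (if t \<in> set cs then k - count_list cs t else 0)" for t
  proof -
    have "count_list ds t = count (mset ds) t" by (simp add: count_mset)
    also have "\<dots> = (\<Sum>u\<in>set cs. if u = t then k - count_list cs u else 0)"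
      by (simp add: ds count_sum)
    finally show ?thesis by (simp)
  qed
  have "count_list (cs @ ds) t = k" if "t \<in> set (cs @ ds)" for t
  proof -
    have "t \<in> set cs" using that count[of t] by (auto simp: count_list_0_iff split: if_splits)
    then show ?thesis using count[of t] assms[of t] by simp
  qed
  then show ?thesis by (rule that)
qed

lemma count_list_card: "count_list xs t = card {i. i < length xs \<and> xs ! i = t}"
  by (simp add: count_list_eq_length_filter length_filter_conv_card eq_commute)

definition path_adj :: "'a list \<Rightarrow> 'a \<Rightarrow> 'a \<Rightarrow> bool" where
  "path_adj vs x y \<longleftrightarrow> (\<exists>i. Suc i < length vs \<and> {x, y} = {vs ! i, vs ! Suc i})"

text \<open>The word of classes along the path is padded until each class occurs exactly three
  times. Then \<open>q t\<close> enumerates the positions of class \<open>t\<close>, and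
  \<open>path_plus_triangles\<close> colours the longer path.\<close>

lemma path_colouring:
  assumes "distinct vs" "fibres_le (set vs) c 3"
  shows "\<exists>col. proper_colouring (set vs) (path_adj vs) c 3 col"
proof -
  define cs where "cs = map c vs"
  have "count_list cs t \<le> 3" for t
  proof -
    have "count_list cs t = length (filter (\<lambda>x. c x = t) vs)"
      by (simp add: cs_def count_list_eq_length_filter filter_map o_def eq_commute)
    also have "\<dots> = card {x \<in> set vs. c x = t}"
      using assms(1) by (metis distinct_card distinct_filter set_filter)
    finally show ?thesis using fibres_leD[OF assms(2), of t] by simp
  qed
  then obtain ds where ds: "\<And>t. t \<in> set (cs @ ds) \<Longrightarrow> count_list (cs @ ds) t = 3"
    using pad_to_multiplicity[of cs 3] by blast
  define es where "es = cs @ ds"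
  have "\<exists>h. bij_betw h {..<3::nat} {i. i < length es \<and> es ! i = t}" if "t \<in> set es" for t
  proof -
    have "card {i. i < length es \<and> es ! i = t} = 3"
      using ds[of t] that by (simp add: es_def count_list_card)
    then show ?thesis by (intro finite_same_card_bij) auto
  qed
  then obtain q where q: "\<And>t. t \<in> set es \<Longrightarrow> bij_betw (q t) {..<3::nat} {i. i < length es \<and> es ! i = t}"
    by metis
  have qD: "q t k < length es \<and> es ! q t k = t" if "t \<in> set es" "k < 3" for t k
    using bij_betwE[OF q[OF that(1)]] that by auto
  have qex: "\<exists>k<3. q (es ! i) k = i" if "i < length es" for i
  proof -
    have "i \<in> q (es ! i) ` {..<3}" using q[of "es ! i"] that by (simp add: bij_betw_def)
    then show ?thesis by auto
  qed
  interpret triples "set es" q "length es"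
  proof
    show "bij_betw (\<lambda>(t, k). q t k) (set es \<times> {..<3}) {..<length es}"
    proof (rule bij_betw_imageI)
      show "inj_on (\<lambda>(t, k). q t k) (set es \<times> {..<3})"
      proof (rule inj_onI, clarify)
        fix t k t' k' assume *: "t \<in> set es" "t' \<in> set es" "k < 3" "k' < 3" "q t k = q t' k'"
        then have "t = t'" using qD by metis
        then show "t = t' \<and> k = k'" using * q[of t] by (auto simp: bij_betw_def inj_on_def)
      qed
      show "(\<lambda>(t, k). q t k) ` (set es \<times> {..<3}) = {..<length es}"
      proof
        show "(\<lambda>(t, k). q t k) ` (set es \<times> {..<3}) \<subseteq> {..<length es}" using qD by auto
        show "{..<length es} \<subseteq> (\<lambda>(t, k). q t k) ` (set es \<times> {..<3})"
        proof
          fix i assume "i \<in> {..<length es}"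
          then have i: "i < length es" by simp
          then obtain k where "k < 3" "q (es ! i) k = i" using qex by blast
          then show "i \<in> (\<lambda>(t, k). q t k) ` (set es \<times> {..<3})"
            using i by (intro image_eqI[of _ _ "(es ! i, k)"]) auto
        qed
      qed
    qed
  qed simp
  obtain x :: "nat \<Rightarrow> gf4" where
    x1: "\<And>i. Suc i < length es \<Longrightarrow> x i \<noteq> x (Suc i)" and
    x2: "\<And>t k k'. \<lbrakk>t \<in> set es; k < 3; k' < 3; k \<noteq> k'\<rbrakk> \<Longrightarrow> x (q t k) \<noteq> x (q t k')" and
    x3: "\<And>i. i < length es \<Longrightarrow> x i \<noteq> 0"
    using path_plus_triangles by blast
  \<comment> \<open>The colours are nonzero and receive the codes \<open>0\<close>,
    \<open>1\<close>, \<open>2\<close>; the value at \<open>GF0\<close> keeps \<open>code\<close>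
    injective.\<close>
  define code :: "gf4 \<Rightarrow> nat" where "code a = (case a of GF0 \<Rightarrow> 3 | GF1 \<Rightarrow> 0 | GFw \<Rightarrow> 1 | GFv \<Rightarrow> 2)" for a
  have code_inj: "code a = code b \<longleftrightarrow> a = b" for a b by (cases a; cases b) (simp_all add: code_def)
  have code_less: "code a < 3" if "a \<noteq> 0" for a using that by (cases a) (simp_all add: code_def zero_gf4_def)
  define pos where "pos v = inv_into {..<length vs} ((!) vs) v" for v
  have pos: "pos (vs ! i) = i" if "i < length vs" for i
    unfolding pos_def using assms(1) that by (intro inv_into_f_f) (auto simp: inj_on_nth)
  have "proper_colouring (set vs) (path_adj vs) c 3 (\<lambda>v. code (x (pos v)))"
    unfolding proper_colouring_def
  proof (intro conjI ballI impI)
    fix v assume "v \<in> set vs"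
    then obtain i where "i < length vs" "v = vs ! i" by (auto simp: in_set_conv_nth)
    then show "code (x (pos v)) < 3" using x3[of i] pos code_less by (simp add: es_def cs_def)
  next
    fix u v assume uv: "u \<in> set vs" "v \<in> set vs" "u \<noteq> v" "path_adj vs u v \<or> c u = c v"
    obtain i where i: "i < length vs" "u = vs ! i" using uv(1) by (auto simp: in_set_conv_nth)
    obtain j where j: "j < length vs" "v = vs ! j" using uv(2) by (auto simp: in_set_conv_nth)
    have le: "i < length es" "j < length es" using i j by (auto simp: es_def cs_def)
    have "x i \<noteq> x j"
      using uv(4)
    proof
      assume "path_adj vs u v"
      then obtain l where l: "Suc l < length vs" "{u, v} = {vs ! l, vs ! Suc l}" by (auto simp: path_adj_def)
      then have "i = l \<and> j = Suc l \<or> i = Suc l \<and> j = l"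
        using i j assms(1) by (auto simp: doubleton_eq_iff nth_eq_iff_index_eq)
      then show ?thesis using x1[of l] l(1) by (auto simp: es_def cs_def)
    next
      assume "c u = c v"
      then have eq: "es ! i = es ! j" using i j by (simp add: es_def cs_def nth_append)
      obtain k k' where k: "k < 3" "q (es ! i) k = i" "k' < 3" "q (es ! i) k' = j"
        using qex[of i] qex[of j] le eq by metis
      moreover have "k \<noteq> k'" using k uv(3) i j by auto
      ultimately show ?thesis using x2[of "es ! i" k k'] le by simp
    qed
    then show "code (x (pos u)) \<noteq> code (x (pos v))" using i j pos code_inj by simp
  qed
  then show ?thesis by blast
qed

text \<open>The vertices without a cut successor form chains; a vertex without predecessor can be put
  immediately in front of its successor.\<close>

lemma linear_forest_order:
  assumes "finite W" "inj_on \<sigma> (W - Q)"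
    and "\<And>U. \<lbrakk>U \<subseteq> W - Q; U \<noteq> {}; \<sigma> ` U = U\<rbrakk> \<Longrightarrow> False"
  shows "\<exists>vs. distinct vs \<and> set vs = W \<and>
    (\<forall>v\<in>W - Q. \<sigma> v \<in> W \<longrightarrow> (\<exists>i. Suc i < length vs \<and> vs ! i = v \<and> vs ! Suc i = \<sigma> v))"
  using assms
proof (induction "card W" arbitrary: W rule: less_induct)
  case less
  note fin = less.prems(1) and inj = less.prems(2) and acyc = less.prems(3)
  show ?case
  proof (cases "W = {}")
    case False
    \<comment> \<open>If every vertex had a predecessor, counting would give
      \<open>W - Q = W\<close> and make \<open>W\<close> itself invariant under
      \<open>\<sigma>\<close>.\<close>
    have "\<not> W \<subseteq> \<sigma> ` (W - Q)"
    proof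
      assume *: "W \<subseteq> \<sigma> ` (W - Q)"
      have "card W \<le> card (\<sigma> ` (W - Q))" using * fin by (intro card_mono) auto
      also have "\<dots> = card (W - Q)" using inj by (rule card_image)
      finally have "W - Q = W" using fin by (intro card_subset_eq) (auto intro: antisym card_mono)
      moreover have "W = \<sigma> ` (W - Q)"
        using * fin \<open>card W \<le> card (\<sigma> ` (W - Q))\<close> inj
        by (metis card_image card_subset_eq finite_Diff finite_imageI calculation)
      ultimately show False using acyc[of W] False by auto
    qed
    then obtain v where v: "v \<in> W" "v \<notin> \<sigma> ` (W - Q)" by blast
    let ?W = "W - {v}"
    have "card ?W < card W" using fin v(1) by (rule card_Diff1_less)
    moreover have "inj_on \<sigma> (?W - Q)" using inj by (rule inj_on_subset) auto
    moreover have "False" if "U \<subseteq> ?W - Q" "U \<noteq> {}" "\<sigma> ` U = U" for U using acyc[of U] that by auto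
    ultimately obtain vs where vs: "distinct vs" "set vs = ?W"
      and adj: "\<And>u. \<lbrakk>u \<in> ?W - Q; \<sigma> u \<in> ?W\<rbrakk> \<Longrightarrow> \<exists>i. Suc i < length vs \<and> vs ! i = u \<and> vs ! Suc i = \<sigma> u"
      using less.hyps[of ?W] fin by (metis finite_Diff)
    show ?thesis
    proof (cases "v \<notin> Q \<and> \<sigma> v \<in> ?W")
      case True
      then obtain as bs where ab: "vs = as @ \<sigma> v # bs" using vs(2) by (metis split_list)
      let ?l = "as @ v # \<sigma> v # bs"
      have "\<exists>i. Suc i < length ?l \<and> ?l ! i = u \<and> ?l ! Suc i = \<sigma> u"
        if u: "u \<in> W - Q" "\<sigma> u \<in> W" for u
      proof (cases "u = v")
        case True
        then show ?thesis by (intro exI[of _ "length as"]) (auto simp: nth_append)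
      next
        case False
        moreover have "\<sigma> u \<noteq> v" using v(2) u by auto
        ultimately obtain i where i: "Suc i < length vs" "vs ! i = u" "vs ! Suc i = \<sigma> u"
          using adj[of u] u by auto
        \<comment> \<open>Inserting \<open>v\<close> separates only the pair that ends in
          \<open>\<sigma> v\<close>; by injectivity that pair is not one of a vertex and its
          required successor.\<close>
        have ne: "\<sigma> u \<noteq> \<sigma> v" using inj u v(1) True False by (auto dest: inj_onD)
        show ?thesis
        proof (cases "Suc i < length as")
          case True
          then show ?thesis using i by (intro exI[of _ i]) (auto simp: ab nth_append)
        next
          case False
          have "Suc i \<noteq> length as" using i ne by (auto simp: ab)
          then have "length as \<le> i" using False by simp
          then show ?thesis using i
            by (intro exI[of _ "Suc i"]) (auto simp: ab nth_append nth_Cons Suc_diff_le split: nat.splits)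
        qed
      qed
      moreover have "distinct ?l" "set ?l = W" using vs v(1) by (auto simp: ab)
      ultimately show ?thesis by blast
    next
      case False
      have "\<exists>i. Suc i < length (v # vs) \<and> (v # vs) ! i = u \<and> (v # vs) ! Suc i = \<sigma> u"
        if u: "u \<in> W - Q" "\<sigma> u \<in> W" for u
      proof -
        have "\<sigma> u \<noteq> v" using v(2) u by auto
        moreover from this have "u \<noteq> v" using False u by auto
        ultimately obtain i where "Suc i < length vs" "vs ! i = u" "vs ! Suc i = \<sigma> u"
          using adj[of u] u by auto
        then show ?thesis by (intro exI[of _ "Suc i"]) auto
      qed
      moreover have "distinct (v # vs)" "set (v # vs) = W" using vs v(1) by auto
      ultimately show ?thesis by blast
    qed
  qed simp
qed

section \<open>Two-regular multigraphs as permutations\<close>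

text \<open>Splitting the incidences both at each edge and at each vertex orients the edges so that every
  vertex has one outgoing and one incoming edge.\<close>

lemma two_regular_permutation:
  fixes F :: "'a set multiset"
  assumes fin: "finite V" and F: "two_regular V F"
  obtains \<sigma> where "\<sigma> permutes V" "\<And>v. v \<in> V \<Longrightarrow> \<sigma> v \<noteq> v" "F = image_mset (\<lambda>v. {v, \<sigma> v}) (mset_set V)"
proof -
  obtain es where es: "mset es = F" using ex_mset by blast
  have edge: "es ! i \<subseteq> V" "card (es ! i) = 2" if "i < length es" for i
    using F that es nth_mem_mset[of i es] by (auto simp: two_regular_def multigraph_def)
  have deg: "card {i. i < length es \<and> v \<in> es ! i} = 2" if "v \<in> V" for v
  proof -
    have "degree F v = length (filter (\<lambda>e. v \<in> e) es)"
      unfolding degree_def es[symmetric] by (metis mset_filter size_mset)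
    then show ?thesis using F that by (simp add: two_regular_def length_filter_conv_card)
  qed
  \<comment> \<open>The incidences of edges, given by their indices, with endpoints. Fibres of
    \<open>fst\<close> are the two ends of an edge, fibres of \<open>snd\<close> the two edges at a
    vertex; \<open>S\<close> will contain the outgoing incidences.\<close>
  define D where "D = {(i, v). i < length es \<and> v \<in> es ! i}"
  have "D \<subseteq> {..<length es} \<times> V" using edge by (auto simp: D_def)
  then have finD: "finite D" using fin by (meson finite_SigmaI finite_lessThan finite_subset)
  have f1: "fibres_le D fst 2"
    unfolding fibres_le_def
  proof (intro conjI allI)
    fix i
    have eq: "{x \<in> D. fst x = i} = (if i < length es then Pair i ` (es ! i) else {})" by (auto simp: D_def)
    show "card {x \<in> D. fst x = i} \<le> 2" unfolding eq using edge[of i] by (auto simp: card_image inj_on_def)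
  qed (rule finD)
  have f2: "fibres_le D snd 2"
    unfolding fibres_le_def
  proof (intro conjI allI)
    fix v
    have eq: "{x \<in> D. snd x = v} = (\<lambda>i. (i, v)) ` {i. i < length es \<and> v \<in> es ! i}" by (auto simp: D_def)
    have "card {x \<in> D. snd x = v} = card {i. i < length es \<and> v \<in> es ! i}"
      unfolding eq by (rule card_image) (auto simp: inj_on_def)
    moreover have "{i. i < length es \<and> v \<in> es ! i} = {}" if "v \<notin> V" using that edge by auto
    ultimately show "card {x \<in> D. snd x = v} \<le> 2" using deg[of v] by (cases "v \<in> V") auto
  qed (rule finD)
  obtain S where S0: "\<forall>x\<in>D. \<forall>y\<in>D. x \<noteq> y \<longrightarrow> fst x = fst y \<or> snd x = snd y \<longrightarrow> (x \<in> S) \<noteq> (y \<in> S)"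
    using split_fibres[OF f1 f2] ..
  have S: "(x \<in> S) \<noteq> (y \<in> S)" if "x \<in> D" "y \<in> D" "x \<noteq> y" "fst x = fst y \<or> snd x = snd y" for x y
    using S0[rule_format, OF that] .
  have ends: "\<exists>u w. es ! i = {u, w} \<and> u \<noteq> w \<and> (i, u) \<in> S \<and> (i, w) \<notin> S" if i: "i < length es" for i
  proof -
    obtain u w where uw: "es ! i = {u, w}" "u \<noteq> w" using edge(2)[OF i] by (auto simp: card_2_iff)
    then have "((i, u) \<in> S) \<noteq> ((i, w) \<in> S)" using S[of "(i, u)" "(i, w)"] i by (auto simp: D_def)
    then show ?thesis using uw by (metis insert_commute)
  qed
  \<comment> \<open>Here \<open>tl\<close> and \<open>hd\<close> denote the tail and the head of an
    edge and shadow the list functions.\<close>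
  then obtain tl hd where th: "\<And>i. i < length es \<Longrightarrow>
      es ! i = {tl i, hd i} \<and> tl i \<noteq> hd i \<and> (i, tl i) \<in> S \<and> (i, hd i) \<notin> S" by metis
  have out: "\<exists>i j. {i. i < length es \<and> v \<in> es ! i} = {i, j} \<and> tl i = v \<and> hd j = v \<and> i \<noteq> j" if v: "v \<in> V" for v
  proof -
    obtain i j where ij: "{i. i < length es \<and> v \<in> es ! i} = {i, j}" "i \<noteq> j"
      using deg[OF v] by (auto simp: card_2_iff)
    then have m: "i < length es" "v \<in> es ! i" "j < length es" "v \<in> es ! j" by auto
    have ne: "((i, v) \<in> S) \<noteq> ((j, v) \<in> S)" using S[of "(i, v)" "(j, v)"] m ij(2) by (auto simp: D_def)
    have tlhd: "tl k = v \<longleftrightarrow> (k, v) \<in> S" "hd k = v \<longleftrightarrow> (k, v) \<notin> S" if "k \<in> {i, j}" for k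
      using th[of k] m that by auto
    show ?thesis
    proof (cases "(i, v) \<in> S")
      case True
      then show ?thesis using ne ij tlhd[of i] tlhd[of j] by auto
    next
      case False
      then have "tl j = v" "hd i = v" using ne tlhd[of i] tlhd[of j] by auto
      then show ?thesis using ij by (metis insert_commute)
    qed
  qed
  have bij_tl: "bij_betw tl {..<length es} V"
  proof (rule bij_betw_imageI)
    show "inj_on tl {..<length es}"
    proof
      fix a b assume ab: "a \<in> {..<length es}" "b \<in> {..<length es}" "tl a = tl b"
      then have v: "tl a \<in> V" using th[of a] edge[of a] by auto
      obtain i j where ij: "{i. i < length es \<and> tl a \<in> es ! i} = {i, j}" "tl i = tl a" "hd j = tl a"
        using out[OF v] by blast
      have "a \<in> {i, j}" "b \<in> {i, j}" unfolding ij(1)[symmetric] using ab th[of a] th[of b] by auto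
      moreover have "a \<noteq> j" "b \<noteq> j" using ij(3) ab th[of a] th[of b] by auto
      ultimately show "a = b" by auto
    qed
    show "tl ` {..<length es} = V"
    proof
      show "tl ` {..<length es} \<subseteq> V" using th edge by fastforce
      show "V \<subseteq> tl ` {..<length es}" using out by (metis (no_types, lifting) image_eqI insertI1 lessThan_iff mem_Collect_eq subsetI)
    qed
  qed
  have bij_hd: "bij_betw hd {..<length es} V"
  proof (rule bij_betw_imageI)
    show "inj_on hd {..<length es}"
    proof
      fix a b assume ab: "a \<in> {..<length es}" "b \<in> {..<length es}" "hd a = hd b"
      then have v: "hd a \<in> V" using th[of a] edge[of a] by auto
      obtain i j where ij: "{i. i < length es \<and> hd a \<in> es ! i} = {i, j}" "tl i = hd a" "hd j = hd a"
        using out[OF v] by blast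
      have "a \<in> {i, j}" "b \<in> {i, j}" unfolding ij(1)[symmetric] using ab th[of a] th[of b] by auto
      moreover have "a \<noteq> i" "b \<noteq> i" using ij(2) ab th[of a] th[of b] by auto
      ultimately show "a = b" by auto
    qed
    show "hd ` {..<length es} = V"
    proof
      show "hd ` {..<length es} \<subseteq> V" using th edge by fastforce
      show "V \<subseteq> hd ` {..<length es}" using out by (metis (no_types, lifting) image_eqI insertI1 insertI2 lessThan_iff mem_Collect_eq subsetI)
    qed
  qed
  \<comment> \<open>\<open>o' v\<close> is the index of the edge leaving \<open>v\<close>, and
    \<open>\<sigma> v\<close> is the head of that edge.\<close>
  define o' where "o' = inv_into {..<length es} tl"
  define \<sigma> where "\<sigma> v = (if v \<in> V then hd (o' v) else v)" for v
  have bij_o: "bij_betw o' V {..<length es}" unfolding o'_def by (rule bij_betw_inv_into[OF bij_tl])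
  have tlo: "tl (o' v) = v" "o' v < length es" if "v \<in> V" for v
  proof -
    show "tl (o' v) = v" using that bij_tl unfolding o'_def by (simp add: bij_betw_inv_into_right)
    show "o' v < length es" using bij_betwE[OF bij_o] that by auto
  qed
  have "bij_betw (hd \<circ> o') V V" using bij_o bij_hd by (rule bij_betw_trans)
  then have "bij_betw \<sigma> V V" by (rule bij_betw_cong[THEN iffD1, rotated]) (simp add: \<sigma>_def)
  then have "\<sigma> permutes V" by (rule bij_imp_permutes) (simp add: \<sigma>_def)
  moreover have "\<sigma> v \<noteq> v" if "v \<in> V" for v
    using th[OF tlo(2)[OF that]] tlo(1)[OF that] that by (auto simp: \<sigma>_def)
  moreover have "F = image_mset (\<lambda>v. {v, \<sigma> v}) (mset_set V)"
  proof -
    have "image_mset (\<lambda>v. {v, \<sigma> v}) (mset_set V) = image_mset (\<lambda>v. es ! o' v) (mset_set V)"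
      by (rule image_mset_cong) (use th tlo in \<open>auto simp: \<sigma>_def fin\<close>)
    also have "\<dots> = image_mset ((!) es) (image_mset o' (mset_set V))" by (simp add: multiset.map_comp o_def)
    also have "image_mset o' (mset_set V) = mset_set {..<length es}"
      using bij_o by (metis bij_betw_def image_mset_mset_set)
    also have "mset_set {..<length es} = mset [0..<length es]"
      by (metis mset_upt atLeast0LessThan)
    also have "image_mset ((!) es) \<dots> = mset es" by (metis map_nth mset_map)
    finally show ?thesis using es by simp
  qed
  ultimately show ?thesis by (rule that)
qed

text \<open>Transfers statements about all cycles of the multigraph to single edges
  \<open>{v, \<sigma> v}\<close>. The orbit is listed from \<open>v\<close> on; an orbit of length
  two yields a pair of parallel edges, one from each of its points.\<close>

lemma permutation_orbit_is_cycle: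
  assumes "finite V" "\<sigma> permutes V" "\<And>v. v \<in> V \<Longrightarrow> \<sigma> v \<noteq> v" "v \<in> V"
    and F: "F = image_mset (\<lambda>v. {v, \<sigma> v}) (mset_set V)"
  obtains vs where "is_cycle F vs" "(v, \<sigma> v) \<in> set (cyclic_pairs vs)"
proof -
  define n where "n = least_power \<sigma> v"
  define vs where "vs = map (\<lambda>i. (\<sigma> ^^ i) v) [0..<n]"
  have perm: "permutation \<sigma>" using assms(1,2) permutation_permutes by blast
  have n: "(\<sigma> ^^ n) v = v" "1 < n"
    using least_power_of_permutation(1)[OF perm] least_power_gt_one[OF perm] assms(3)[OF assms(4)]
    by (auto simp: n_def)
  have dist: "distinct vs" using cycle_of_permutation[OF perm, of v] by (simp add: vs_def n_def)
  have inV: "(\<sigma> ^^ i) v \<in> V" for i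
    by (induction i) (use assms(2,4) in \<open>auto simp: permutes_in_image\<close>)
  have rot: "rotate1 vs = map \<sigma> vs"
  proof (rule nth_equalityI)
    fix i assume "i < length (rotate1 vs)"
    then have i: "i < n" by (simp add: vs_def)
    then have "rotate1 vs ! i = vs ! (Suc i mod n)" by (simp add: nth_rotate1 vs_def)
    also have "\<dots> = (\<sigma> ^^ Suc i) v"
      using i n by (cases "Suc i = n") (auto simp: vs_def)
    finally show "rotate1 vs ! i = map \<sigma> vs ! i" using i by (simp add: vs_def)
  qed simp
  have pairs: "cyclic_pairs vs = map (\<lambda>v. (v, \<sigma> v)) vs"
    by (simp add: cyclic_pairs_def rot zip_map2 zip_same_conv_map)
  have "edges_of_pairs (cyclic_pairs vs) = image_mset (\<lambda>v. {v, \<sigma> v}) (mset vs)"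
    by (simp add: edges_of_pairs_def pairs o_def)
  also have "mset vs = mset_set (set vs)" using dist by (simp add: mset_set_set)
  also have "image_mset (\<lambda>v. {v, \<sigma> v}) (mset_set (set vs)) \<subseteq># F"
    unfolding F using inV assms(1)
    by (intro image_mset_subseteq_mono subset_imp_msubset_mset_set) (auto simp: vs_def)
  finally have "is_cycle F vs" using n dist by (simp add: is_cycle_def vs_def)
  moreover have "v \<in> set vs" using n(2) by (auto simp: vs_def intro!: image_eqI[of _ _ 0])
  then have "(v, \<sigma> v) \<in> set (cyclic_pairs vs)" by (simp add: pairs)
  ultimately show ?thesis by (rule that)
qed

section \<open>Four and five colours\<close>

lemma enumerate_fibres:
  assumes "finite E"
  obtains r :: "'a \<Rightarrow> nat" where "\<And>v. bij_betw r {x \<in> E. c x = v} {..<card {x \<in> E. c x = v}}"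
proof -
  have "\<exists>h. bij_betw h {x \<in> E. c x = v} {..<card {x \<in> E. c x = v}}" for v
    using assms by (intro finite_same_card_bij) auto
  then obtain h where h: "\<And>v. bij_betw (h v) {x \<in> E. c x = v} {..<card {x \<in> E. c x = v}}" by metis
  have "bij_betw (\<lambda>x. h (c x) x) {x \<in> E. c x = v} {..<card {x \<in> E. c x = v}}" for v
    using h[of v] by (rule bij_betw_cong[THEN iffD1, rotated]) auto
  then show ?thesis by (rule that)
qed

text \<open>A first split \<open>S\<close> separates the edges of \<open>f1\<close> and halves each
  class; a second split \<open>T\<close> separates the edges of \<open>f2\<close> and the points
  left together in a half. The colour records both sides.\<close>

lemma two_matchings_colouring:
  assumes f1: "fibres_le E f1 2" and f2: "fibres_le E f2 2" and c: "fibres_le E c 4"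
    and adj: "\<And>x y. adj x y \<Longrightarrow> f1 x = f1 y \<or> f2 x = f2 y"
  shows "\<exists>col. proper_colouring E adj c 4 col"
proof -
  have fin: "finite E" using c by (simp add: fibres_le_def)
  obtain r :: "'a \<Rightarrow> nat" where r: "\<And>v. bij_betw r {x \<in> E. c x = v} {..<card {x \<in> E. c x = v}}"
    using enumerate_fibres[OF fin, of c] by blast
  have r_inj: "x = y" if "x \<in> E" "y \<in> E" "c x = c y" "r x = r y" for x y
    using r[of "c x"] that by (auto simp: bij_betw_def inj_on_def)
  have r_less: "r x < 4" if "x \<in> E" for x
  proof -
    have "r x < card {y \<in> E. c y = c x}" using bij_betwE[OF r[of "c x"]] that by auto
    then show ?thesis using fibres_leD[OF c, of "c x"] by simp
  qed
  \<comment> \<open>Each class is cut into at most two pairs; \<open>S\<close> separates the points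
    of a pair, so at most two points of a class lie on the same side.\<close>
  define g where "g x = (c x, r x div 2)" for x
  have g: "fibres_le E g 2"
  proof (rule fibres_le_2I[OF fin])
    fix x y z assume *: "x \<in> E" "y \<in> E" "z \<in> E" "g x = g y" "g x = g z"
    then have "r x div 2 = r y div 2" "r x div 2 = r z div 2" by (auto simp: g_def)
    moreover have "n = 2 * (n div 2) \<or> n = Suc (2 * (n div 2))" for n :: nat by presburger
    ultimately have "r x = r y \<or> r x = r z \<or> r y = r z" by metis
    then show "x = y \<or> x = z \<or> y = z" using r_inj * by (auto simp: g_def)
  qed
  obtain S where S: "\<forall>x\<in>E. \<forall>y\<in>E. x \<noteq> y \<longrightarrow> f1 x = f1 y \<or> g x = g y \<longrightarrow> (x \<in> S) \<noteq> (y \<in> S)"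
    using split_fibres[OF f1 g] ..
  define g' where "g' x = (c x, x \<in> S)" for x
  have g': "fibres_le E g' 2"
  proof (rule fibres_le_2I[OF fin])
    fix x y z assume *: "x \<in> E" "y \<in> E" "z \<in> E" "g' x = g' y" "g' x = g' z"
    then have eq: "c x = c y" "c x = c z" "x \<in> S \<longleftrightarrow> y \<in> S" "x \<in> S \<longleftrightarrow> z \<in> S" by (auto simp: g'_def)
    have "r x div 2 < 2" "r y div 2 < 2" "r z div 2 < 2" using r_less * by (simp_all add: div_less_iff_less_mult)
    then have "r x div 2 = r y div 2 \<or> r x div 2 = r z div 2 \<or> r y div 2 = r z div 2" by linarith
    then have "g x = g y \<or> g x = g z \<or> g y = g z" using eq by (auto simp: g_def)
    then show "x = y \<or> x = z \<or> y = z" using S eq(3,4) *(1-3) by metis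
  qed
  obtain T where T: "\<forall>x\<in>E. \<forall>y\<in>E. x \<noteq> y \<longrightarrow> f2 x = f2 y \<or> g' x = g' y \<longrightarrow> (x \<in> T) \<noteq> (y \<in> T)"
    using split_fibres[OF f2 g'] ..
  define col :: "'a \<Rightarrow> nat" where "col x = 2 * of_bool (x \<in> S) + of_bool (x \<in> T)" for x
  have col_eq: "col x = col y \<longleftrightarrow> (x \<in> S \<longleftrightarrow> y \<in> S) \<and> (x \<in> T \<longleftrightarrow> y \<in> T)" for x y
    by (auto simp: col_def of_bool_def)
  have "proper_colouring E adj c 4 col"
    unfolding proper_colouring_def
  proof (intro conjI ballI impI)
    fix x show "col x < 4" by (simp add: col_def of_bool_def)
  next
    fix x y assume *: "x \<in> E" "y \<in> E" "x \<noteq> y" "adj x y \<or> c x = c y"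
    show "col x \<noteq> col y"
    proof
      assume "col x = col y"
      then have eq: "x \<in> S \<longleftrightarrow> y \<in> S" "x \<in> T \<longleftrightarrow> y \<in> T" by (auto simp: col_eq)
      then have "f1 x \<noteq> f1 y" "f2 x \<noteq> f2 y" "g' x \<noteq> g' y" using S T * by metis+
      then show False using adj[of x y] *(4) eq by (auto simp: g'_def)
    qed
  qed
  then show ?thesis by blast
qed

text \<open>The edges \<open>{v, \<sigma> v}\<close> with \<open>v\<close> in \<open>X\<close> form
  the fibres of one matching, those with \<open>v\<close> in \<open>Y\<close> the fibres of another;
  each edge is contracted to its starting point \<open>v\<close>.\<close>

lemma alternating_permutation_colouring:
  assumes fin: "finite E" and \<sigma>: "\<sigma> permutes V" and VE: "V \<subseteq> E"
    and XY: "V = X \<union> Y" "X \<inter> Y = {}" and alt: "\<sigma> ` X \<subseteq> Y" "\<sigma> ` Y \<subseteq> X"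
    and c: "fibres_le E c 4"
  shows "\<exists>col. proper_colouring E (\<lambda>x y. \<exists>v\<in>V. {x, y} = {v, \<sigma> v}) c 4 col"
proof -
  let ?i = "inv \<sigma>"
  have inv: "?i (\<sigma> v) = v" "\<sigma> (?i v) = v" for v using \<sigma> by (simp_all add: permutes_inverses)
  have iY: "?i v \<in> X" if "v \<in> Y" for v
  proof -
    have "?i v \<in> V" using that XY permutes_in_image[OF permutes_inv[OF \<sigma>]] by auto
    then show ?thesis using alt XY that inv(2)[of v] by (metis IntI UnE emptyE image_subset_iff)
  qed
  have iX: "?i v \<in> Y" if "v \<in> X" for v
  proof -
    have "?i v \<in> V" using that XY permutes_in_image[OF permutes_inv[OF \<sigma>]] by auto
    then show ?thesis using alt XY that inv(2)[of v] by (metis IntI UnE emptyE image_subset_iff)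
  qed
  define f1 where "f1 v = (if v \<in> Y then ?i v else v)" for v
  define f2 where "f2 v = (if v \<in> X then ?i v else v)" for v
  have "fibres_le E f1 2"
  proof (rule fibres_le_2I[OF fin])
    fix x y z assume "f1 x = f1 y" "f1 x = f1 z"
    then show "x = y \<or> x = z \<or> y = z"
      unfolding f1_def using inv(2) by (smt (verit, ccfv_threshold))
  qed
  moreover have "fibres_le E f2 2"
  proof (rule fibres_le_2I[OF fin])
    fix x y z assume "f2 x = f2 y" "f2 x = f2 z"
    then show "x = y \<or> x = z \<or> y = z"
      unfolding f2_def using inv(2) by (smt (verit, ccfv_threshold))
  qed
  moreover have "f1 x = f1 y \<or> f2 x = f2 y" if xy: "\<exists>v\<in>V. {x, y} = {v, \<sigma> v}" for x y
  proof -
    obtain v where v: "v \<in> V" "{x, y} = {v, \<sigma> v}" using xy by blast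
    have "f1 v = f1 (\<sigma> v) \<or> f2 v = f2 (\<sigma> v)"
    proof (cases "v \<in> X")
      case True
      then have "\<sigma> v \<in> Y" "v \<notin> Y" using alt XY by auto
      then show ?thesis by (simp add: f1_def inv)
    next
      case False
      then have "v \<in> Y" using v XY by auto
      then have "\<sigma> v \<in> X" using alt by auto
      then show ?thesis using False by (simp add: f2_def inv)
    qed
    then show ?thesis using v(2) by (auto simp: doubleton_eq_iff)
  qed
  ultimately show ?thesis using c by (rule_tac two_matchings_colouring)
qed

section \<open>Orbits of a permutation and positions on them\<close>

locale finite_permutation =
  fixes E :: "'a set" and \<sigma> :: "'a \<Rightarrow> 'a"
  assumes finite_E: "finite E" and permutes: "\<sigma> permutes E"
begin

definition orb :: "'a \<Rightarrow> 'a set" where "orb x = range (\<lambda>i. (\<sigma> ^^ i) x)"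

lemma permutation: "permutation \<sigma>"
  using finite_E permutes permutation_permutes by blast

lemma orb_eq_image: "orb x = (\<lambda>i. (\<sigma> ^^ i) x) ` {..<least_power \<sigma> x}"
  using support_set[OF permutation, of x] by (auto simp: orb_def atLeast0LessThan)

lemma card_orb: "card (orb x) = least_power \<sigma> x"
proof -
  have "distinct (map (\<lambda>i. (\<sigma> ^^ i) x) [0..<least_power \<sigma> x])" using cycle_of_permutation[OF permutation] .
  then have "inj_on (\<lambda>i. (\<sigma> ^^ i) x) {..<least_power \<sigma> x}"
    by (simp add: distinct_map atLeast0LessThan)
  then show ?thesis unfolding orb_eq_image by (simp add: card_image)
qed

lemma inj_on_orb: "inj_on (\<lambda>i. (\<sigma> ^^ i) x) {..<card (orb x)}"
  using card_orb[of x] by (intro eq_card_imp_inj_on) (simp_all flip: orb_eq_image)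

lemma funpow_card_orb: "(\<sigma> ^^ card (orb x)) x = x"
  using least_power_of_permutation(1)[OF permutation] by (simp add: card_orb)

lemma card_orb_pos: "0 < card (orb x)"
  using least_power_of_permutation(2)[OF permutation] by (simp add: card_orb)

lemma orb_self: "x \<in> orb x"
  unfolding orb_def by (metis funpow_0 rangeI)

lemma orb_eq:
  assumes "y \<in> orb x" shows "orb y = orb x"
proof -
  obtain i where i: "i < least_power \<sigma> x" "y = (\<sigma> ^^ i) x" using assms by (auto simp: orb_eq_image)
  have sub: "orb ((\<sigma> ^^ j) z) \<subseteq> orb z" for j z
    by (auto simp: orb_def simp flip: funpow_add[THEN fun_cong, simplified comp_apply])
  have "(\<sigma> ^^ (least_power \<sigma> x - i)) y = (\<sigma> ^^ (least_power \<sigma> x - i + i)) x"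
    unfolding i(2) by (simp add: funpow_add)
  also have "\<dots> = x" using i(1) funpow_card_orb[of x] by (simp add: card_orb)
  finally have "orb x \<subseteq> orb y" using sub[of "least_power \<sigma> x - i" y] by simp
  then show ?thesis using sub[of i x] i(2) by auto
qed

lemma sigma_in_orb: "\<sigma> x \<in> orb x"
  unfolding orb_def by (rule range_eqI[of _ _ 1]) simp

lemma orb_sigma: "orb (\<sigma> x) = orb x"
  by (rule orb_eq[OF sigma_in_orb])

lemma orb_subset: "x \<in> E \<Longrightarrow> orb x \<subseteq> E"
proof -
  assume "x \<in> E"
  then have "(\<sigma> ^^ i) x \<in> E" for i by (induction i) (auto simp: permutes_in_image[OF permutes])
  then show ?thesis by (auto simp: orb_def)
qed

lemma orb_fibre: "x \<in> E \<Longrightarrow> {y \<in> E. orb y = orb x} = orb x"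
  using orb_subset orb_eq orb_self by blast

lemma orb_subset_invariant:
  assumes "x \<in> U" "\<sigma> ` U = U" shows "orb x \<subseteq> U"
proof -
  have "(\<sigma> ^^ i) x \<in> U" for i by (induction i) (use assms in auto)
  then show ?thesis by (auto simp: orb_def)
qed

definition index :: "'a \<Rightarrow> 'a \<Rightarrow> nat" where
  "index b x = inv_into {..<card (orb b)} (\<lambda>i. (\<sigma> ^^ i) b) x"

lemma index:
  assumes "x \<in> orb b" shows "index b x < card (orb b)" "(\<sigma> ^^ index b x) b = x"
proof -
  have x: "x \<in> (\<lambda>i. (\<sigma> ^^ i) b) ` {..<card (orb b)}"
    using assms unfolding card_orb by (simp add: orb_eq_image)
  show "index b x < card (orb b)" using inv_into_into[OF x] by (simp add: index_def)
  show "(\<sigma> ^^ index b x) b = x" using f_inv_into_f[OF x] by (simp add: index_def)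
qed

lemma index_eqI: "i < card (orb b) \<Longrightarrow> (\<sigma> ^^ i) b = x \<Longrightarrow> index b x = i"
  unfolding index_def by (rule inv_into_f_eq[OF inj_on_orb]) auto

lemma index_sigma:
  assumes "x \<in> orb b"
  shows "index b (\<sigma> x) = (if Suc (index b x) = card (orb b) then 0 else Suc (index b x))"
proof (rule index_eqI)
  show "(if Suc (index b x) = card (orb b) then 0 else Suc (index b x)) < card (orb b)"
    using index(1)[OF assms] card_orb_pos[of b] by auto
  have "(\<sigma> ^^ Suc (index b x)) b = \<sigma> x" using index(2)[OF assms] by simp
  then show "(\<sigma> ^^ (if Suc (index b x) = card (orb b) then 0 else Suc (index b x))) b = \<sigma> x"
    using funpow_card_orb[of b] by (cases "Suc (index b x) = card (orb b)") (simp_all del: funpow.simps)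
qed

end

context finite_permutation
begin

text \<open>The cells are pairs of consecutive vertices of the cycles. One vertex of each odd cycle of length
  at least \<open>5\<close> is put into \<open>Z\<close>, as it would be left over in the pairing; in a triangle the left-over
  vertex does no harm because its two neighbours share a cell.\<close>

lemma cells:
  fixes c :: "'a \<Rightarrow> 'b"
  assumes c: "fibres_le E c 5"
  obtains Z and cell :: "'a \<Rightarrow> 'a set \<times> nat" where
    "Z \<subseteq> E" "inj_on c Z" "inj_on orb Z" "\<And>z. z \<in> Z \<Longrightarrow> 5 \<le> card (orb z)"
    "\<And>x. fst (cell x) = orb x" "fibres_le E cell 2"
    "\<And>w. \<lbrakk>w \<in> E; w \<notin> Z; \<sigma> w \<notin> Z; \<sigma> (\<sigma> w) \<notin> Z; \<sigma> (\<sigma> w) \<noteq> w; \<sigma> w \<noteq> w\<rbrakk>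
        \<Longrightarrow> cell w = cell (\<sigma> w) \<or> cell (\<sigma> w) = cell (\<sigma> (\<sigma> w)) \<or> cell w = cell (\<sigma> (\<sigma> w))"
proof -
  define I where "I = {P \<in> orb ` E. odd (card P) \<and> 5 \<le> card P}"
  have "\<exists>h. (\<forall>P\<in>I. h P \<in> E \<and> orb (h P) = P) \<and> inj_on (\<lambda>P. c (h P)) I"
  proof (rule transversal_of_fibres[OF _ _ c])
    show "finite I" using finite_E by (simp add: I_def)
    fix P assume "P \<in> I"
    then obtain x where "x \<in> E" "P = orb x" "5 \<le> card P" by (auto simp: I_def)
    then show "5 \<le> card {y \<in> E. orb y = P}" using orb_fibre by simp
  qed simp
  then obtain h where h: "\<And>P. P \<in> I \<Longrightarrow> h P \<in> E" "\<And>P. P \<in> I \<Longrightarrow> orb (h P) = P"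
    and inj: "inj_on (\<lambda>P. c (h P)) I" by blast
  define Z where "Z = h ` I"
  \<comment> \<open>On an odd cycle of length at least \<open>5\<close> the numbering starts just
    after the selected point, which thus gets the last index and is the one left over by the
    pairing.\<close>
  define base where "base P = (if P \<in> I then \<sigma> (h P) else (SOME x. x \<in> P))" for P
  have base: "base (orb x) \<in> orb x" for x
  proof (cases "orb x \<in> I")
    case True
    then show ?thesis using sigma_in_orb[of "h (orb x)"] h(2)[of "orb x"] by (simp add: base_def)
  next
    case False
    then show ?thesis using someI[of "\<lambda>y. y \<in> orb x", OF orb_self] by (simp add: base_def)
  qed
  then have orb_base: "orb (base (orb x)) = orb x" for x using orb_eq by blast
  define idx where "idx x = index (base (orb x)) x" for x
  have mem: "x \<in> orb (base (orb x))" for x using orb_base orb_self by simp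
  have idx_less: "idx x < card (orb x)" for x
    using index(1)[OF mem[of x]] orb_base[of x] by (simp add: idx_def)
  have idx_sigma: "idx (\<sigma> x) = (if Suc (idx x) = card (orb x) then 0 else Suc (idx x))" for x
    using index_sigma[OF mem[of x]] orb_base[of x] by (simp add: idx_def orb_sigma)
  have idx_funpow: "(\<sigma> ^^ idx x) (base (orb x)) = x" for x
    unfolding idx_def by (rule index(2)[OF mem])
  have idx_inj: "x = y" if "orb x = orb y" "idx x = idx y" for x y
    using idx_funpow that by metis
  have idx_last: "x \<in> Z" if "x \<in> E" "odd (card (orb x))" "5 \<le> card (orb x)" "Suc (idx x) = card (orb x)" for x
  proof -
    have I: "orb x \<in> I" using that by (auto simp: I_def)
    let ?n = "card (orb x)"
    have "(\<sigma> ^^ (?n - 1)) (\<sigma> (h (orb x))) = (\<sigma> ^^ Suc (?n - 1)) (h (orb x))" by (simp only: funpow_Suc_right comp_apply)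
    also have "\<dots> = h (orb x)" using funpow_card_orb[of "h (orb x)"] h(2)[OF I] that(3) by simp
    also have "?n - 1 = idx x" using that(4) by simp
    finally have "(\<sigma> ^^ idx x) (base (orb x)) = h (orb x)" using I by (simp add: base_def)
    then have "x = h (orb x)" unfolding idx_funpow .
    then show ?thesis using I by (auto simp: Z_def)
  qed
  define cell where "cell x = (orb x, idx x div 2)" for x
  show ?thesis
  proof (rule that[of Z cell])
    show "Z \<subseteq> E" using h by (auto simp: Z_def)
    show "inj_on c Z" using inj by (auto simp: Z_def inj_on_def)
    show "inj_on orb Z" using h(2) by (auto simp: Z_def inj_on_def)
    show "5 \<le> card (orb z)" if "z \<in> Z" for z using that h(2) by (auto simp: Z_def I_def)
    show "fst (cell x) = orb x" for x by (simp add: cell_def)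
    show "fibres_le E cell 2"
    proof (rule fibres_le_2I[OF finite_E])
      fix x y z assume "cell x = cell y" "cell x = cell z"
      then have eq: "orb x = orb y" "orb x = orb z" "idx x div 2 = idx y div 2" "idx x div 2 = idx z div 2"
        by (auto simp: cell_def)
      have "n = 2 * (n div 2) \<or> n = Suc (2 * (n div 2))" for n :: nat by presburger
      then have "idx x = idx y \<or> idx x = idx z \<or> idx y = idx z" using eq by metis
      then show "x = y \<or> x = z \<or> y = z" using idx_inj eq by metis
    qed
    fix w assume w: "w \<in> E" "w \<notin> Z" "\<sigma> w \<notin> Z" "\<sigma> (\<sigma> w) \<notin> Z" "\<sigma> (\<sigma> w) \<noteq> w" "\<sigma> w \<noteq> w"
    let ?n = "card (orb w)" and ?i = "idx w"
    have orbs: "orb (\<sigma> w) = orb w" "orb (\<sigma> (\<sigma> w)) = orb w" by (simp_all add: orb_sigma)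
    have E: "\<sigma> w \<in> E" using w(1) permutes_in_image[OF permutes] by simp
    have n1: "?n \<noteq> 1"
    proof
      assume "?n = 1"
      then show False using funpow_card_orb[of w] w by simp
    qed
    have n2: "?n \<noteq> 2"
    proof
      assume "?n = 2"
      then show False using funpow_card_orb[of w] w by (simp add: numeral_2_eq_2)
    qed
    have n3: "3 \<le> ?n" using n1 n2 card_orb_pos[of w] by linarith
    have i: "?i < ?n" by (rule idx_less)
    consider "even ?i" "Suc ?i < ?n" | "Suc ?i = ?n" | "odd ?i" "Suc (Suc ?i) < ?n" | "odd ?i" "Suc (Suc ?i) = ?n"
      using i by linarith
    then show "cell w = cell (\<sigma> w) \<or> cell (\<sigma> w) = cell (\<sigma> (\<sigma> w)) \<or> cell w = cell (\<sigma> (\<sigma> w))"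
    proof cases
      case 1
      then have "idx (\<sigma> w) div 2 = ?i div 2" by (simp add: idx_sigma)
      then show ?thesis by (simp add: cell_def orbs)
    next
      case 2
      then have "idx (\<sigma> w) = 0" "idx (\<sigma> (\<sigma> w)) = 1" using n3 by (simp_all add: idx_sigma orbs)
      then show ?thesis by (simp add: cell_def orbs)
    next
      case 3
      then have "idx (\<sigma> w) = Suc ?i" "idx (\<sigma> (\<sigma> w)) = Suc (Suc ?i)" by (simp_all add: idx_sigma orbs)
      then show ?thesis using 3 by (simp add: cell_def orbs)
    \<comment> \<open>Here \<open>\<sigma> w\<close> is the last point of an odd cycle. Length at
      least \<open>5\<close> would put it into \<open>Z\<close>, so the cycle is a triangle, and
      \<open>w\<close> and its second successor have the indices \<open>1\<close> and
      \<open>0\<close>.\<close>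
    next
      case 4
      then have s: "idx (\<sigma> w) = Suc ?i" "idx (\<sigma> (\<sigma> w)) = 0" by (simp_all add: idx_sigma orbs)
      have "odd ?n" using 4 by (metis even_Suc)
      have "\<not> 5 \<le> ?n" using idx_last[OF E] w(3) s(1) 4 \<open>odd ?n\<close> by (auto simp: orbs)
      then have "?n = 3" using n3 \<open>odd ?n\<close> by (cases "?n = 4") auto
      then have "?i = 1" using 4 by simp
      then show ?thesis using s by (simp add: cell_def orbs)
    qed
  qed
qed

text \<open>Each fibre minus \<open>Z\<close> is cut into two slots of at most three points. One matching between cells
  and slots meets all long cycles, another one all slots with two points; Mendelsohn--Dulmage
  combines them.\<close>

lemma hitting_matching:
  fixes c :: "'a \<Rightarrow> 'b"
  assumes c: "fibres_le E c 5"
  obtains M where "M \<subseteq> E" "fibres_le M c 2" "fibres_le (E - M) c 3"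
    "\<And>x. \<lbrakk>x \<in> E; 3 \<le> card (orb x)\<rbrakk> \<Longrightarrow> orb x \<inter> M \<noteq> {}"
    "\<And>w. \<lbrakk>w \<in> M; \<sigma> w \<in> M; \<sigma> (\<sigma> w) \<in> M\<rbrakk> \<Longrightarrow> \<sigma> w = w \<or> \<sigma> (\<sigma> w) = w"
proof -
  obtain Z and cell :: "'a \<Rightarrow> 'a set \<times> nat" where
    Z: "Z \<subseteq> E" "inj_on c Z" "inj_on orb Z" "\<And>z. z \<in> Z \<Longrightarrow> 5 \<le> card (orb z)"
    and cell: "\<And>x. fst (cell x) = orb x" "fibres_le E cell 2"
    and cell3: "\<And>w. \<lbrakk>w \<in> E; w \<notin> Z; \<sigma> w \<notin> Z; \<sigma> (\<sigma> w) \<notin> Z; \<sigma> (\<sigma> w) \<noteq> w; \<sigma> w \<noteq> w\<rbrakk>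
        \<Longrightarrow> cell w = cell (\<sigma> w) \<or> cell (\<sigma> w) = cell (\<sigma> (\<sigma> w)) \<or> cell w = cell (\<sigma> (\<sigma> w))"
    using cells[OF c] by blast
  define D where "D = E - Z"
  have finD: "finite D" "finite Z" using finite_E Z(1) by (auto simp: D_def intro: finite_subset)
  have cD: "fibres_le D c 5" using c by (rule fibres_le_subset) (auto simp: D_def)
  obtain r :: "'a \<Rightarrow> nat" where r: "\<And>v. bij_betw r {x \<in> D. c x = v} {..<card {x \<in> D. c x = v}}"
    using enumerate_fibres[OF finD(1), of c] by blast
  \<comment> \<open>The points of a class are numbered from \<open>0\<close>: the first slot takes
    the numbers \<open>0\<close> and \<open>1\<close>, the second one the rest, at most
    \<open>2\<close>, \<open>3\<close>, \<open>4\<close>.\<close>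
  define slot where "slot x = (c x, of_bool (2 \<le> r x) :: nat)" for x
  have r_inj: "x = y" if "x \<in> D" "y \<in> D" "c x = c y" "r x = r y" for x y
    using r[of "c x"] that by (auto simp: bij_betw_def inj_on_def)
  have r_less: "r x < card {y \<in> D. c y = c x}" if "x \<in> D" for x
    using bij_betwE[OF r[of "c x"]] that by auto
  have r_ex: "\<exists>x\<in>D. c x = v \<and> r x = i" if "i < card {x \<in> D. c x = v}" for v i
  proof -
    have "i \<in> r ` {x \<in> D. c x = v}" using r[of v] that by (simp add: bij_betw_def)
    then show ?thesis by auto
  qed
  have slot_le: "fibres_le D slot 3"
    unfolding fibres_le_def
  proof (intro conjI allI)
    fix s
    have "inj_on r {x \<in> D. slot x = s}" using r_inj by (auto simp: inj_on_def slot_def)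
    then have "card {x \<in> D. slot x = s} = card (r ` {x \<in> D. slot x = s})" by (simp add: card_image)
    also have "\<dots> \<le> 3"
    proof -
      have r5: "r x < 5" if "x \<in> D" for x using r_less[OF that] fibres_leD[OF cD, of "c x"] by simp
      have "r ` {x \<in> D. slot x = s} \<subseteq> (if snd s = 0 then {..<2} else {2..<5})"
        using r5 by (auto simp: slot_def split: if_splits)
      then have "card (r ` {x \<in> D. slot x = s}) \<le> card (if snd s = 0 then {..<2::nat} else {2..<5})"
        by (intro card_mono) auto
      then show ?thesis by (auto split: if_splits)
    qed
    finally show "card {x \<in> D. slot x = s} \<le> 3" .
  qed (rule finD(1))

  \<comment> \<open>Every cycle of length at least \<open>3\<close> keeps three points outside
    \<open>Z\<close>, since \<open>Z\<close> takes at most one point, and only from cycles of length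
    at least \<open>5\<close>. Slots have at most three points, so a transversal exists.\<close>
  define I where "I = {P \<in> orb ` E. 3 \<le> card P}"
  have "\<exists>h. (\<forall>P\<in>I. h P \<in> D \<and> orb (h P) = P) \<and> inj_on (\<lambda>P. slot (h P)) I"
  proof (rule transversal_of_fibres[OF _ _ slot_le])
    show "finite I" using finite_E by (simp add: I_def)
    fix P assume "P \<in> I"
    then obtain x where x: "x \<in> E" "P = orb x" "3 \<le> card P" by (auto simp: I_def)
    have eq: "{y \<in> D. orb y = P} = P - {z \<in> Z. orb z = P}"
      using orb_fibre[OF x(1)] x(2) by (auto simp: D_def)
    show "3 \<le> card {y \<in> D. orb y = P}"
    proof (cases "{z \<in> Z. orb z = P} = {}")
      case True
      show ?thesis unfolding eq True using x(3) by simp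
    next
      case False
      then obtain z where z: "z \<in> Z" "orb z = P" by blast
      then have "{z \<in> Z. orb z = P} = {z}" using Z(3) by (auto simp: inj_on_def)
      then have "card {y \<in> D. orb y = P} = card P - 1" using eq z orb_self[of z] by simp
      then show ?thesis using Z(4)[OF z(1)] z(2) by simp
    qed
  qed simp
  then obtain h where h: "\<And>P. P \<in> I \<Longrightarrow> h P \<in> D" "\<And>P. P \<in> I \<Longrightarrow> orb (h P) = P"
    and inj_h: "inj_on (\<lambda>P. slot (h P)) I" by blast
  define M1 where "M1 = h ` I"
  have M1: "M1 \<subseteq> D" "inj_on slot M1" "inj_on cell M1"
  proof -
    show "M1 \<subseteq> D" using h by (auto simp: M1_def)
    show "inj_on slot M1" using inj_h by (auto simp: M1_def inj_on_def)
    show "inj_on cell M1"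
    proof
      fix x y assume *: "x \<in> M1" "y \<in> M1" "cell x = cell y"
      then have "orb x = orb y" using cell(1) by metis
      then show "x = y" using * h(2) by (auto simp: M1_def)
    qed
  qed

  \<comment> \<open>Two points are kept of each slot that has at least two. Splitting cells and
    slots simultaneously leaves one point in each of these slots and at most one in each
    cell.\<close>
  define B where "B = {s. 2 \<le> card {x \<in> D. slot x = s}}"
  have "\<exists>X. X \<subseteq> {x \<in> D. slot x = s} \<and> card X = 2" if "s \<in> B" for s
    using that unfolding B_def by (meson mem_Collect_eq obtain_subset_with_card_n)
  then obtain X where X: "\<And>s. s \<in> B \<Longrightarrow> X s \<subseteq> {x \<in> D. slot x = s}" "\<And>s. s \<in> B \<Longrightarrow> card (X s) = 2" by metis
  define D2 where "D2 = (\<Union>s\<in>B. X s)"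
  have D2: "D2 \<subseteq> D" using X(1) by (auto simp: D2_def)
  have D2X: "{x \<in> D2. slot x = s} = (if s \<in> B then X s else {})" for s
  proof -
    have "slot x = s'" if "s' \<in> B" "x \<in> X s'" for x s' using X(1)[OF that(1)] that(2) by blast
    then show ?thesis unfolding D2_def by (cases "s \<in> B") (simp_all, blast+)
  qed
  have D2_cell: "fibres_le D2 cell 2" by (rule fibres_le_subset[OF cell(2)]) (use D2 in \<open>auto simp: D_def\<close>)
  have D2_slot: "fibres_le D2 slot 2"
    unfolding fibres_le_def using D2 finD X(2) by (auto simp: D2X intro: finite_subset)
  obtain S where S: "\<forall>x\<in>D2. \<forall>y\<in>D2. x \<noteq> y \<longrightarrow> cell x = cell y \<or> slot x = slot y \<longrightarrow> (x \<in> S) \<noteq> (y \<in> S)"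
    using split_fibres[OF D2_cell D2_slot] ..
  define M2 where "M2 = D2 \<inter> S"
  have M2: "M2 \<subseteq> D" "inj_on cell M2" "inj_on slot M2" using D2 S by (auto simp: M2_def inj_on_def)
  have BM2: "B \<subseteq> slot ` M2"
  proof
    fix s assume s: "s \<in> B"
    obtain a b where ab: "X s = {a, b}" "a \<noteq> b" using X(2)[OF s] by (auto simp: card_2_iff)
    then have "{a, b} \<subseteq> {x \<in> D2. slot x = s}" using D2X[of s] s by simp
    then have *: "a \<in> D2" "b \<in> D2" "slot a = s" "slot b = s" by auto
    then have "(a \<in> S) \<noteq> (b \<in> S)" using S[rule_format, OF *(1,2) ab(2)] by simp
    then have "a \<in> M2 \<or> b \<in> M2" using * by (auto simp: M2_def)
    then show "s \<in> slot ` M2" using *(3,4) by (metis imageI)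
  qed

  have "finite M1" "finite M2" using finite_subset[OF _ finD(1)] M1(1) M2(1) by auto
  \<comment> \<open>Points are viewed as edges between their cell and their slot. The cells of
    \<open>M1\<close> ensure that long cycles are met, the slots of \<open>M2\<close> that large
    classes are met.\<close>
  then obtain M where M: "M \<subseteq> M1 \<union> M2" "inj_on cell M" "inj_on slot M"
    "cell ` M1 \<subseteq> cell ` M" "slot ` M2 \<subseteq> slot ` M"
    by (rule mendelsohn_dulmage[OF _ _ M1(3,2) M2(2,3)])
  have MD: "M \<subseteq> D" using M(1) M1 M2 by auto
  have finM: "finite M" using MD finD by (auto intro: finite_subset)
  have slotM: "\<exists>x\<in>M. slot x = s" if "s \<in> B" for s
  proof -
    have "s \<in> slot ` M" using that BM2 M(5) by blast
    then show ?thesis by auto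
  qed
  have two: "s \<in> B" if ij: "i < card {x \<in> D. c x = fst s}" "j < card {x \<in> D. c x = fst s}" "i \<noteq> j"
    "of_bool (2 \<le> i) = snd s" "of_bool (2 \<le> j) = snd s" for s i j
  proof -
    obtain x where x: "x \<in> D" "c x = fst s" "r x = i" using r_ex[OF ij(1)] by blast
    obtain y where y: "y \<in> D" "c y = fst s" "r y = j" using r_ex[OF ij(2)] by blast
    have "{x, y} \<subseteq> {x \<in> D. slot x = s}" using x y ij by (auto simp: slot_def prod_eq_iff)
    then have "card {x, y} \<le> card {x \<in> D. slot x = s}" using finD by (intro card_mono) auto
    moreover have "x \<noteq> y" using x y ij by auto
    ultimately show ?thesis by (simp add: B_def)
  qed
  show ?thesis
  proof (rule that[of M])
    show "M \<subseteq> E" using MD by (auto simp: D_def)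
    show "fibres_le M c 2"
    proof (rule fibres_le_2I[OF finM])
      fix x y z assume *: "x \<in> M" "y \<in> M" "z \<in> M" "c x = c y" "c x = c z"
      then have "slot x = slot y \<or> slot x = slot z \<or> slot y = slot z" by (auto simp: slot_def of_bool_def)
      then show "x = y \<or> x = z \<or> y = z" using * M(3) by (auto dest: inj_onD)
    qed
    show "fibres_le (E - M) c 3"
      unfolding fibres_le_def
    proof (intro conjI allI)
      fix v
      let ?E = "{x \<in> E. c x = v}" and ?D = "{x \<in> D. c x = v}" and ?Z = "{x \<in> Z. c x = v}"
        and ?M = "{x \<in> M. c x = v}"
      \<comment> \<open>At most one point of the class lies in \<open>Z\<close>. If four or five
        points lie in \<open>D\<close>, both slots are met by \<open>M\<close>; if three, the first
        slot is. In each case at most three points of the class remain.\<close>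
      have "card ?Z \<le> 1"
        using Z(2) by (auto simp: card_le_Suc0_iff_eq finD inj_on_def)
      moreover have "card ?E = card ?D + card ?Z"
      proof -
        have "?E = ?D \<union> ?Z" using Z(1) by (auto simp: D_def)
        then show ?thesis using finD by (simp add: card_Un_disjoint D_def disjoint_iff)
      qed
      moreover have "card {x \<in> E - M. c x = v} = card ?E - card ?M"
      proof -
        have "{x \<in> E - M. c x = v} = ?E - ?M" by auto
        moreover have "?M \<subseteq> ?E" using MD by (auto simp: D_def)
        ultimately show ?thesis using finM by (simp add: card_Diff_subset)
      qed
      moreover have "card ?E \<le> 5" by (rule fibres_leD[OF c])
      moreover have "2 \<le> card ?M" if d: "4 \<le> card ?D"
      proof -
        have "(v, 0) \<in> B" by (rule two[of 0 _ 1]) (use d in auto)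
        moreover have "(v, 1) \<in> B" by (rule two[of 2 _ 3]) (use d in auto)
        ultimately obtain x y where "x \<in> M" "slot x = (v, 0)" "y \<in> M" "slot y = (v, 1)" using slotM by metis
        then have "{x, y} \<subseteq> ?M" "x \<noteq> y" by (auto simp: slot_def)
        then have "card {x, y} \<le> card ?M" using finM by (intro card_mono) auto
        then show ?thesis using \<open>x \<noteq> y\<close> by simp
      qed
      moreover have "1 \<le> card ?M" if d: "3 \<le> card ?D"
      proof -
        have "(v, 0) \<in> B" by (rule two[of 0 _ 1]) (use d in auto)
        then obtain x where "x \<in> M" "slot x = (v, 0)" using slotM by metis
        then have "x \<in> ?M" by (auto simp: slot_def)
        then have "card {x} \<le> card ?M" using finM by (intro card_mono) auto
        then show ?thesis by simp
      qed
      ultimately show "card {x \<in> E - M. c x = v} \<le> 3" by linarith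
    qed (use finite_E in simp)
    show "orb x \<inter> M \<noteq> {}" if x: "x \<in> E" "3 \<le> card (orb x)" for x
    proof -
      have I: "orb x \<in> I" using x by (auto simp: I_def)
      then have "cell (h (orb x)) \<in> cell ` M" using M(4) by (auto simp: M1_def)
      then obtain m where m: "m \<in> M" "cell m = cell (h (orb x))" by auto
      then have "orb m = orb x" using cell(1) h(2)[OF I] by metis
      then show ?thesis using m orb_self[of m] by auto
    qed
    show "\<sigma> w = w \<or> \<sigma> (\<sigma> w) = w" if w: "w \<in> M" "\<sigma> w \<in> M" "\<sigma> (\<sigma> w) \<in> M" for w
    proof (rule ccontr)
      assume *: "\<not> ?thesis"
      have "\<sigma> (\<sigma> w) \<noteq> \<sigma> w" using * permutes_inj[OF permutes] by (auto dest: injD)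
      \<comment> \<open>Two of three consecutive points outside \<open>Z\<close> share a cell,
        whereas \<open>M\<close> has at most one point in each cell.\<close>
      moreover have "cell w = cell (\<sigma> w) \<or> cell (\<sigma> w) = cell (\<sigma> (\<sigma> w)) \<or> cell w = cell (\<sigma> (\<sigma> w))"
        using cell3[of w] w * MD by (auto simp: D_def)
      ultimately show False using * w inj_onD[OF M(2)] by metis
    qed
  qed
qed

lemma permutation_colouring:
  fixes c :: "'a \<Rightarrow> 'b"
  assumes c: "fibres_le E c 5"
  shows "\<exists>col. proper_colouring E (\<lambda>x y. y = \<sigma> x \<or> x = \<sigma> y) c 5 col"
proof -
  obtain M where M: "M \<subseteq> E" "fibres_le M c 2" "fibres_le (E - M) c 3"
    and hit: "\<And>x. \<lbrakk>x \<in> E; 3 \<le> card (orb x)\<rbrakk> \<Longrightarrow> orb x \<inter> M \<noteq> {}"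
    and match: "\<And>w. \<lbrakk>w \<in> M; \<sigma> w \<in> M; \<sigma> (\<sigma> w) \<in> M\<rbrakk> \<Longrightarrow> \<sigma> w = w \<or> \<sigma> (\<sigma> w) = w"
    using hitting_matching[OF c] by blast
  have finM: "finite M" using M(1) finite_E by (rule finite_subset)
  have inj: "x = y" if "\<sigma> x = \<sigma> y" for x y using that permutes_inj[OF permutes] by (auto dest: injD)
  let ?adj = "\<lambda>x y. y = \<sigma> x \<or> x = \<sigma> y"
  \<comment> \<open>Closed neighbourhoods inside \<open>M\<close>. As \<open>M\<close> induces a
    matching, they are constant on edges and have fibres of size at most \<open>2\<close>, so one
    split serves both the edges and the classes inside \<open>M\<close>.\<close>
  define N where "N u = {w \<in> M. w = u \<or> ?adj u w}" for u
  have three: "x = y \<or> x = z \<or> y = z" if "x \<in> M" "y \<in> M" "z \<in> M" "y \<in> N x" "z \<in> N x" for x y z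
    using that match[of y] match[of z] inj by (auto simp: N_def)
  have Nadj: "N x = N y" if "x \<in> M" "y \<in> M" "?adj x y" for x y
  proof (cases "x = y")
    case False
    have "N u = {u, v}" if uv: "u \<in> M" "v \<in> M" "?adj u v" "u \<noteq> v" for u v
    proof
      have "v \<in> N u" using uv by (auto simp: N_def)
      then have "w \<in> {u, v}" if "w \<in> N u" for w
        using three[OF uv(1,2) _ _ that] that uv(4) by (simp add: N_def) blast
      then show "N u \<subseteq> {u, v}" by blast
      show "{u, v} \<subseteq> N u" using uv by (auto simp: N_def)
    qed
    from this[of x y] this[of y x] show ?thesis using that False by auto
  qed simp
  have fN: "fibres_le M N 2"
  proof (rule fibres_le_2I[OF finM])
    fix x y z assume *: "x \<in> M" "y \<in> M" "z \<in> M" "N x = N y" "N x = N z"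
    then have "y \<in> N x" "z \<in> N x" by (auto simp: N_def[of y] N_def[of z])
    then show "x = y \<or> x = z \<or> y = z" using three * by blast
  qed
  obtain S where S: "\<forall>x\<in>M. \<forall>y\<in>M. x \<noteq> y \<longrightarrow> N x = N y \<or> c x = c y \<longrightarrow> (x \<in> S) \<noteq> (y \<in> S)"
    using split_fibres[OF fN M(2)] ..

  define rep :: "'a set \<Rightarrow> 'a" where "rep P = (SOME x. x \<in> P)" for P
  have rep: "rep (orb x) \<in> orb x" for x unfolding rep_def by (rule someI[of _ x]) (rule orb_self)
  \<comment> \<open>One point of each orbit of length at most \<open>2\<close>, where the orbit is
    cut open; the longer orbits are already cut by \<open>M\<close>.\<close>
  define Q where "Q = {v. card (orb v) \<le> 2 \<and> v = rep (orb v)}"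
  let ?W = "E - M"
  have "\<exists>vs. distinct vs \<and> set vs = ?W \<and>
    (\<forall>v\<in>?W - Q. \<sigma> v \<in> ?W \<longrightarrow> (\<exists>i. Suc i < length vs \<and> vs ! i = v \<and> vs ! Suc i = \<sigma> v))"
  proof (rule linear_forest_order)
    show "finite ?W" using finite_E by simp
    show "inj_on \<sigma> (?W - Q)" using inj by (auto simp: inj_on_def)
    fix U assume U: "U \<subseteq> ?W - Q" "U \<noteq> {}" "\<sigma> ` U = U"
    then obtain u where u: "u \<in> U" by blast
    then have orbU: "orb u \<subseteq> U" using U(3) by (rule orb_subset_invariant)
    show False
    proof (cases "3 \<le> card (orb u)")
      case True
      then show False using hit[of u] u U(1) orbU by blast
    next
      case False
      have "rep (orb u) \<in> Q" using False orb_eq[OF rep[of u]] by (simp add: Q_def)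
      then show False using rep[of u] orbU U(1) by blast
    qed
  qed
  then obtain vs where vs: "distinct vs" "set vs = ?W"
    and succ: "\<And>v. \<lbrakk>v \<in> ?W - Q; \<sigma> v \<in> ?W\<rbrakk> \<Longrightarrow> \<exists>i. Suc i < length vs \<and> vs ! i = v \<and> vs ! Suc i = \<sigma> v"
    by blast
  have padj: "path_adj vs v (\<sigma> v)" if "v \<in> ?W - Q" "\<sigma> v \<in> ?W" for v
    using succ[OF that] by (auto simp: path_adj_def)
  have path_sym: "path_adj vs x y = path_adj vs y x" for x y by (simp add: path_adj_def insert_commute)
  \<comment> \<open>If the arc leaving \<open>v\<close> was cut, the orbit has two points, and the
    parallel arc from \<open>\<sigma> v\<close> back to \<open>v\<close> is still on the
    path.\<close>
  have padj': "path_adj vs v (\<sigma> v)" if v: "v \<in> ?W" "\<sigma> v \<in> ?W" "v \<noteq> \<sigma> v" for v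
  proof (cases "v \<in> Q")
    case True
    have "card (orb v) \<noteq> 1" using funpow_card_orb[of v] v(3) by auto
    then have "card (orb v) = 2" using True card_orb_pos[of v] by (auto simp: Q_def)
    then have ssv: "\<sigma> (\<sigma> v) = v" using funpow_card_orb[of v] by (simp add: numeral_2_eq_2)
    have "\<sigma> v \<notin> Q" using True v(3) by (auto simp: Q_def orb_sigma)
    then have "path_adj vs (\<sigma> v) (\<sigma> (\<sigma> v))" using v ssv by (intro padj) auto
    then show ?thesis using ssv path_sym by simp
  next
    case False
    then show ?thesis using v by (intro padj) auto
  qed
  obtain col where col: "proper_colouring ?W (path_adj vs) c 3 col"
    using path_colouring[OF vs(1), of c] M(3) vs(2) by auto
  \<comment> \<open>Colours \<open>3\<close> and \<open>4\<close> are reserved for \<open>M\<close>;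
    the path outside uses \<open>0\<close>, \<open>1\<close>, \<open>2\<close>.\<close>
  define col' where "col' x = (if x \<in> M then if x \<in> S then 3 else 4 else col x)" for x
  have less: "col x < 3" if "x \<in> ?W" for x using col that by (auto simp: proper_colouring_def)
  have "proper_colouring E ?adj c 5 col'"
    unfolding proper_colouring_def
  proof (intro conjI ballI impI)
    fix x assume "x \<in> E"
    then show "col' x < 5" using less[of x] by (auto simp: col'_def)
  next
    fix x y assume xy: "x \<in> E" "y \<in> E" "x \<noteq> y" "?adj x y \<or> c x = c y"
    show "col' x \<noteq> col' y"
    proof (cases "x \<in> M"; cases "y \<in> M")
      assume m: "x \<in> M" "y \<in> M"
      then have "N x = N y \<or> c x = c y" using xy(4) Nadj by blast
      then have "(x \<in> S) \<noteq> (y \<in> S)" using S m xy(3) by blast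
      then show ?thesis using m by (auto simp: col'_def)
    next
      assume m: "x \<notin> M" "y \<notin> M"
      have "path_adj vs x y \<or> c x = c y"
      proof -
        have W: "x \<in> ?W" "y \<in> ?W" using m xy(1,2) by auto
        consider "y = \<sigma> x" | "x = \<sigma> y" | "c x = c y" using xy(4) by blast
        then show ?thesis
        proof cases
          case 1 then show ?thesis using padj'[of x] W xy(3) by simp
        next
          case 2 then show ?thesis using padj'[of y] W xy(3) path_sym by simp
        qed simp
      qed
      then have "col x \<noteq> col y" using col m xy(1-3) unfolding proper_colouring_def by blast
      then show ?thesis using m by (simp add: col'_def)
    next
      assume m: "x \<in> M" "y \<notin> M"
      then show ?thesis using less[of y] xy by (auto simp: col'_def)
    next
      assume m: "x \<notin> M" "y \<in> M"
      then show ?thesis using less[of x] xy by (auto simp: col'_def)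
    qed
  qed
  then show ?thesis by blast
qed

end

section \<open>Covering by common independent sets\<close>

lemma covering_number_leD:
  assumes "covering_number E I \<le> enat k"
  obtains F where "finite F" "F \<subseteq> I" "E \<subseteq> \<Union>F" "card F \<le> k"
proof -
  have "(INF F\<in>{F. finite F \<and> F \<subseteq> I \<and> E \<subseteq> \<Union>F}. enat (card F)) < enat (Suc k)"
    using assms unfolding covering_number_def by (metis enat_ord_simps(2) le_less_trans lessI)
  then show ?thesis using that by (auto simp: INF_less_iff)
qed

lemma covering_number_leI:
  assumes "finite F" "F \<subseteq> I" "E \<subseteq> \<Union>F" "card F \<le> k"
  shows "covering_number E I \<le> enat k"
  unfolding covering_number_def by (rule INF_lower2[of F]) (use assms in auto)

section \<open>Circuits, bases and independent colour classes\<close>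

context matroid
begin

lemma dependent_contains_circuit:
  assumes "X \<subseteq> E" "X \<notin> \<I>"
  shows "\<exists>C\<in>circuits E \<I>. C \<subseteq> X"
  using assms
proof (induction "card X" arbitrary: X rule: less_induct)
  case less
  show ?case
  proof (cases "\<exists>D. D \<subset> X \<and> D \<notin> \<I>")
    case True
    then obtain D where D: "D \<subset> X" "D \<notin> \<I>" by blast
    have "finite X" using less.prems(1) finite_ground by (rule finite_subset)
    then have "card D < card X" using D(1) by (rule psubset_card_mono)
    then show ?thesis using less.hyps[of D] D less.prems by blast
  next
    case False
    then show ?thesis using less.prems by (intro bexI[of _ X]) (auto simp: circuits_def)
  qed
qed

lemma indep_extends_to_base:
  assumes "X \<in> \<I>"
  shows "\<exists>B\<in>bases \<I>. X \<subseteq> B"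
proof -
  have "\<I> \<subseteq> Pow E" using indep_subset_ground by blast
  then have "finite \<I>" using finite_ground by (meson finite_Pow_iff finite_subset)
  then obtain B where "B \<in> \<I>" "X \<subseteq> B" "\<forall>Y\<in>\<I>. B \<subseteq> Y \<longrightarrow> B = Y"
    using finite_has_maximal2[OF _ assms] by blast
  then show ?thesis by (auto simp: bases_def)
qed

lemma covered_by_two_bases:
  assumes "covering_number E \<I> \<le> 2"
  obtains A B where "A \<in> bases \<I>" "B \<in> bases \<I>" "A \<union> B = E"
proof -
  have "covering_number E \<I> \<le> enat 2" using assms by (simp add: numeral_eq_enat)
  then obtain F where F: "finite F" "F \<subseteq> \<I>" "E \<subseteq> \<Union>F" "card F \<le> 2"
    by (rule covering_number_leD)
  have "\<exists>X Y. X \<in> \<I> \<and> Y \<in> \<I> \<and> E \<subseteq> X \<union> Y"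
  proof -
    consider "card F = 0" | "card F = 1" | "card F = 2" using F(4) by linarith
    then show ?thesis
    proof cases
      case 1 then show ?thesis using F empty_indep by auto
    next
      case 2 then show ?thesis using F by (auto simp: card_1_singleton_iff)
    next
      case 3
      then obtain X Y where "F = {X, Y}" by (auto simp: card_2_iff)
      then have "X \<in> \<I>" "Y \<in> \<I>" "E \<subseteq> X \<union> Y" using F(2,3) by simp_all
      then show ?thesis by blast
    qed
  qed
  then obtain X Y where XY: "X \<in> \<I>" "Y \<in> \<I>" "E \<subseteq> X \<union> Y" by blast
  obtain A where A: "A \<in> bases \<I>" "X \<subseteq> A" using indep_extends_to_base[OF XY(1)] by blast
  obtain B where B: "B \<in> bases \<I>" "Y \<subseteq> B" using indep_extends_to_base[OF XY(2)] by blast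
  have "A \<subseteq> E" "B \<subseteq> E" using A(1) B(1) by (simp_all add: bases_def indep_subset_ground)
  then have "A \<union> B = E" using XY(3) A(2) B(2) by blast
  with A(1) B(1) show ?thesis by (rule that)
qed

text \<open>A dependent colour class would contain a circuit and with it both ends of an edge of
  \<open>F\<close>, which have different colours. So the colour classes are common independent
  sets.\<close>

lemma covering_number_le_of_colouring:
  assumes I2: "\<I>2 = {X. X \<subseteq> E \<and> (\<forall>p\<in>P. card (X \<inter> p) \<le> 1)}"
    and c: "\<And>x y p. \<lbrakk>p \<in> P; x \<in> p; y \<in> p\<rbrakk> \<Longrightarrow> c x = c y"
    and F: "covers F (circuits_in E \<I> E)" "\<And>e. e \<in># F \<Longrightarrow> card e = 2"
    and adj: "\<And>x y. {x, y} \<in># F \<Longrightarrow> adj x y"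
    and col: "proper_colouring E adj c k col"
  shows "covering_number E (\<I> \<inter> \<I>2) \<le> enat k"
proof -
  define K where "K i = {x \<in> E. col x = i}" for i
  have differ: "col x \<noteq> col y" if "x \<in> E" "y \<in> E" "x \<noteq> y" "adj x y \<or> c x = c y" for x y
    using col that by (auto simp: proper_colouring_def)
  have K1: "K i \<in> \<I>" for i
  proof (rule ccontr)
    assume "K i \<notin> \<I>"
    then obtain C where C: "C \<in> circuits E \<I>" "C \<subseteq> K i"
      using dependent_contains_circuit[of "K i"] by (auto simp: K_def)
    then have "C \<in> circuits_in E \<I> E" by (auto simp: circuits_in_def K_def)
    then obtain e where e: "e \<in># F" "e \<subseteq> C" using F(1) by (auto simp: covers_def)
    obtain x y where "e = {x, y}" "x \<noteq> y" using F(2)[OF e(1)] by (auto simp: card_2_iff)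
    then show False using differ[of x y] adj[of x y] e C(2) by (auto simp: K_def)
  qed
  have K2: "K i \<in> \<I>2" for i
  proof -
    have "card (K i \<inter> p) \<le> 1" if p: "p \<in> P" for p
    proof -
      have "finite (K i \<inter> p)" using finite_ground by (simp add: K_def)
      moreover have "x = y" if "x \<in> K i \<inter> p" "y \<in> K i \<inter> p" for x y
        using that differ[of x y] c[OF p, of x y] by (auto simp: K_def)
      ultimately show ?thesis by (simp add: card_le_Suc0_iff_eq)
    qed
    then show ?thesis by (auto simp: I2 K_def)
  qed
  show ?thesis
  proof (rule covering_number_leI[of "K ` {..<k}"])
    show "E \<subseteq> \<Union> (K ` {..<k})" using col by (auto simp: K_def proper_colouring_def)
    show "card (K ` {..<k}) \<le> k" using card_image_le[of "{..<k}" K] by simp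
  qed (use K1 K2 in auto)
qed

end

definition part_of :: "'a set set \<Rightarrow> 'a \<Rightarrow> 'a set" where
  "part_of P x = \<Union>{p \<in> P. x \<in> p}"

lemma part_of_eq:
  assumes "partition_on E P" "p \<in> P" "x \<in> p"
  shows "part_of P x = p"
proof -
  have "{q \<in> P. x \<in> q} = {p}"
    using assms by (auto simp: partition_on_def disjoint_def)
  then show ?thesis by (simp add: part_of_def)
qed

text \<open>Each of at most \<open>k\<close> covering sets meets a class in at most one point, so a
  class has at most \<open>k\<close> points.\<close>

lemma fibres_le_part_of:
  assumes "finite E" and P: "partition_on E P"
    and I2: "\<I>2 = {X. X \<subseteq> E \<and> (\<forall>p\<in>P. card (X \<inter> p) \<le> 1)}"
    and cov: "covering_number E \<I>2 \<le> enat k"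
  shows "fibres_le E (part_of P) k"
  unfolding fibres_le_def
proof (intro conjI allI)
  obtain F where F: "finite F" "F \<subseteq> \<I>2" "E \<subseteq> \<Union>F" "card F \<le> k"
    using cov by (rule covering_number_leD)
  fix v
  show "card {x \<in> E. part_of P x = v} \<le> k"
  proof (cases "{x \<in> E. part_of P x = v} = {}")
    case False
    then obtain x where x: "x \<in> E" "part_of P x = v" by blast
    then obtain p where p: "p \<in> P" "x \<in> p" using P by (auto simp: partition_on_def)
    then have v: "v \<in> P" using part_of_eq[OF P p] x(2) by simp
    have "{x \<in> E. part_of P x = v} \<subseteq> (\<Union>X\<in>F. X \<inter> v)"
    proof
      fix y assume y: "y \<in> {x \<in> E. part_of P x = v}"
      then obtain q where q: "q \<in> P" "y \<in> q" using P by (auto simp: partition_on_def)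
      then have "y \<in> v" using part_of_eq[OF P q] y by simp
      then show "y \<in> (\<Union>X\<in>F. X \<inter> v)" using F(3) y by auto
    qed
    moreover have "finite (\<Union>X\<in>F. X \<inter> v)"
      using F(1,2) assms(1) by (auto simp: I2 intro: finite_subset)
    ultimately have "card {x \<in> E. part_of P x = v} \<le> card (\<Union>X\<in>F. X \<inter> v)" by (rule card_mono[rotated])
    also have "\<dots> \<le> (\<Sum>X\<in>F. card (X \<inter> v))" using F(1) by (rule card_UN_le)
    also have "\<dots> \<le> (\<Sum>X\<in>F. 1)" using F(2) v by (intro sum_mono) (auto simp: I2)
    finally show ?thesis using F(4) by simp
  next
    case True
    then show ?thesis by (simp only: card.empty)
  qed
qed (rule assms(1))

lemma path_edges_elim:
  assumes "e \<in># path_edges vs"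
  obtains i where "Suc i < length vs" "e = {vs ! i, vs ! Suc i}"
proof -
  obtain u w where uw: "(u, w) \<in> set (zip vs (tl vs))" "e = {u, w}"
    using assms by (auto simp: path_edges_def edges_of_pairs_def)
  then obtain i where i: "i < length vs" "i < length (tl vs)" "u = vs ! i" "w = tl vs ! i"
    by (auto simp: in_set_zip)
  then show ?thesis using that[of i] uw(2) by (simp add: nth_tl)
qed

theorem theorem19:
  fixes E :: "'a set" and \<I>1 \<I>2 :: "'a set set" and k :: nat
  assumes "matroid E \<I>1" and "loopless E \<I>1" and "covering_number E \<I>1 \<le> 2"
    and "partition_matroid E \<I>2" and "covering_number E \<I>2 \<le> enat k"
  shows "(3 \<le> k \<and> property_P E \<I>1 \<longrightarrow> covering_number E (\<I>1 \<inter> \<I>2) \<le> enat k) \<and>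
         (4 \<le> k \<and> property_R_plus E \<I>1 \<longrightarrow> covering_number E (\<I>1 \<inter> \<I>2) \<le> enat k) \<and>
         (5 \<le> k \<and> property_R E \<I>1 \<longrightarrow> covering_number E (\<I>1 \<inter> \<I>2) \<le> enat k)"
proof -
  interpret matroid E \<I>1 by fact
  obtain A B where A: "A \<in> bases \<I>1" and B: "B \<in> bases \<I>1" and AB: "A \<union> B = E"
    using assms(3) by (rule covered_by_two_bases)
  obtain P where P: "partition_on E P" and I2: "\<I>2 = {X. X \<subseteq> E \<and> (\<forall>p\<in>P. card (X \<inter> p) \<le> 1)}"
    using assms(4) by (auto simp: partition_matroid_def)
  let ?V = "(A - B) \<union> (B - A)" and ?c = "part_of P"
  have c: "fibres_le E ?c k" using finite_ground P I2 assms(5) by (rule fibres_le_part_of)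
  have c_eq: "?c x = ?c y" if "p \<in> P" "x \<in> p" "y \<in> p" for x y p
    using that part_of_eq[OF P] by simp
  have VE: "?V \<subseteq> E" and finV: "finite ?V" using AB finite_ground by auto
  note cover = covering_number_le_of_colouring[OF I2 c_eq]
  show ?thesis
  proof (intro conjI impI; elim conjE)
    assume k: "3 \<le> k" and "property_P E \<I>1"
    then obtain vs where vs: "distinct vs" "set vs = ?V" "covers (path_edges vs) (circuits_in E \<I>1 (A \<union> B))"
      using A B unfolding property_P_def by blast
    \<comment> \<open>The points of \<open>A \<inter> B\<close> also need colours. Appending them to
      the path only adds constraints.\<close>
    obtain ws where ws: "distinct ws" "set ws = A \<inter> B"
      using finite_distinct_list[of "A \<inter> B"] AB finite_ground by blast
    have E: "set (vs @ ws) = E" "distinct (vs @ ws)" using vs ws AB by auto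
    have adj: "path_adj (vs @ ws) x y" if xy: "{x, y} \<in># path_edges vs" for x y
    proof -
      obtain i where "Suc i < length vs" "{x, y} = {vs ! i, vs ! Suc i}"
        using xy by (rule path_edges_elim)
      then show ?thesis unfolding path_adj_def by (intro exI[of _ i]) (simp add: nth_append)
    qed
    have "card e = 2" if "e \<in># path_edges vs" for e
      using that by (rule path_edges_elim) (use vs(1) in \<open>auto simp: nth_eq_iff_index_eq\<close>)
    moreover have "\<exists>col. proper_colouring E (path_adj (vs @ ws)) ?c k col"
    proof (rule proper_colouring_ge[OF finite_ground _ _ k c])
      fix c' :: "'a \<Rightarrow> 'a set + 'a" assume "fibres_le E c' 3"
      then show "\<exists>col. proper_colouring E (path_adj (vs @ ws)) c' 3 col"
        using path_colouring[OF E(2), of c'] unfolding E(1) by blast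
    qed simp
    then obtain col where "proper_colouring E (path_adj (vs @ ws)) ?c k col" ..
    ultimately show "covering_number E (\<I>1 \<inter> \<I>2) \<le> enat k"
      using vs(3) adj unfolding AB by (rule_tac cover)
  next
    assume k: "4 \<le> k" and "property_R_plus E \<I>1"
    then obtain F where F: "two_regular ?V F" "covers F (circuits_in E \<I>1 (A \<union> B))"
      and cyc: "\<And>vs. is_cycle F vs \<Longrightarrow> alternates (A - B) (B - A) vs"
      using A B unfolding property_R_plus_def by blast
    obtain \<sigma> where \<sigma>: "\<sigma> permutes ?V" "\<And>v. v \<in> ?V \<Longrightarrow> \<sigma> v \<noteq> v" "F = image_mset (\<lambda>v. {v, \<sigma> v}) (mset_set ?V)"
      using two_regular_permutation[OF finV F(1)] by blast
    \<comment> \<open>Every arc of \<open>\<sigma>\<close> lies on a cycle of the graph, namely its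
      orbit, so the alternation of cycles applies to it.\<close>
    have alt: "(v \<in> A - B \<and> \<sigma> v \<in> B - A) \<or> (v \<in> B - A \<and> \<sigma> v \<in> A - B)" if v: "v \<in> ?V" for v
    proof -
      obtain vs where "is_cycle F vs" "(v, \<sigma> v) \<in> set (cyclic_pairs vs)"
        using permutation_orbit_is_cycle[OF finV \<sigma>(1,2) v \<sigma>(3)] by blast
      then show ?thesis using cyc[of vs] by (auto simp: alternates_def)
    qed
    let ?adj = "\<lambda>x y. \<exists>v\<in>?V. {x, y} = {v, \<sigma> v}"
    have "\<exists>col. proper_colouring E ?adj ?c k col"
    proof (rule proper_colouring_ge[OF finite_ground _ _ k c])
      fix c' :: "'a \<Rightarrow> 'a set + 'a" assume c': "fibres_le E c' 4"
      show "\<exists>col. proper_colouring E ?adj c' 4 col"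
        by (rule alternating_permutation_colouring[OF finite_ground \<sigma>(1) VE refl _ _ _ c'])
           (use alt in auto)
    qed simp
    then obtain col where "proper_colouring E ?adj ?c k col" ..
    moreover have "?adj x y" if "{x, y} \<in># F" for x y using that finV by (auto simp: \<sigma>(3))
    moreover have "card e = 2" if "e \<in># F" for e
      using F(1) that by (auto simp: two_regular_def multigraph_def)
    ultimately show "covering_number E (\<I>1 \<inter> \<I>2) \<le> enat k"
      using F(2) unfolding AB by (rule_tac cover)
  next
    assume k: "5 \<le> k" and "property_R E \<I>1"
    then obtain F where F: "two_regular ?V F" "covers F (circuits_in E \<I>1 (A \<union> B))"
      using A B unfolding property_R_def by blast
    obtain \<sigma> where \<sigma>: "\<sigma> permutes ?V" "F = image_mset (\<lambda>v. {v, \<sigma> v}) (mset_set ?V)"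
      using two_regular_permutation[OF finV F(1)] by blast
    \<comment> \<open>Extended by the identity, \<open>\<sigma>\<close> permutes all of
      \<open>E\<close>, with the points of \<open>A \<inter> B\<close> as fixed points.\<close>
    interpret finite_permutation E \<sigma>
      using finite_ground permutes_subset[OF \<sigma>(1) VE] by unfold_locales
    let ?adj = "\<lambda>x y. y = \<sigma> x \<or> x = \<sigma> y"
    have "\<exists>col. proper_colouring E ?adj ?c k col"
      by (rule proper_colouring_ge[OF finite_ground _ permutation_colouring k c]) simp_all
    then obtain col where "proper_colouring E ?adj ?c k col" ..
    moreover have "?adj x y" if "{x, y} \<in># F" for x y
      using that finV by (auto simp: \<sigma>(2) doubleton_eq_iff)
    moreover have "card e = 2" if "e \<in># F" for e
      using F(1) that by (auto simp: two_regular_def multigraph_def)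
    ultimately show "covering_number E (\<I>1 \<inter> \<I>2) \<le> enat k"
      using F(2) unfolding AB by (rule_tac cover)
  qed
qed

end
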